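(* Let $\mathbf n\ge 2$ and let $M_{\langle\mathbf n\rangle}\in\mathbb C^{\mathbf n^2}\otimes\mathbb C^{\mathbf n^2}\otimes\mathbb C^{\mathbf n^2}$ be the $\mathbf n\times\mathbf n$ matrix multiplication tensor. Then $\underline{\mathbf R}(M_{\langle\mathbf n\rangle})\ge 2\mathbf n^2-\mathbf n+1$.
   Context: $M_{\langle\mathbf n\rangle}=\sum_{i,j,k=1}^{\mathbf n}x^i_j\otimes y^j_k\otimes z^k_i$ where $\{x^i_j\},\{y^j_k\},\{z^k_i\}$ are bases of the three copies of $\mathbb C^{\mathbf n^2}$. The border rank $\underline{\mathbf R}(T)$ of a tensor $T$ is the smallest $r$ such that $T$ is a limit of sums of $r$ rank one tensors $a\otimes b\otimes c$. *)

theory Defs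
  imports "HOL-Analysis.Analysis"
begin

text \<open>Tensors in C^{n^2} (x) C^{n^2} (x) C^{n^2}: the basis of each factor C^{n^2}
  is indexed by pairs (i,j) with i,j < n (basis vectors x^i_j, etc.).
  A tensor is its coefficient function; only indices in mat_idx n matter.\<close>

type_synonym idx = "nat \<times> nat"
type_synonym tensor3 = "idx \<Rightarrow> idx \<Rightarrow> idx \<Rightarrow> complex"

definition mat_idx :: "nat \<Rightarrow> idx set" where
  "mat_idx n = {..<n} \<times> {..<n}"

definition matmult_tensor :: "nat \<Rightarrow> tensor3" where
  "matmult_tensor n = (\<lambda>(i, j) (j', k) (k', i').
     if i < n \<and> j < n \<and> k < n \<and> j' = j \<and> k' = k \<and> i' = i then 1 else 0)"

definition sum_rank_one ::
  "nat \<Rightarrow> (nat \<Rightarrow> idx \<Rightarrow> complex) \<Rightarrow> (nat \<Rightarrow> idx \<Rightarrow> complex) \<Rightarrow> (nat \<Rightarrow> idx \<Rightarrow> complex) \<Rightarrow> tensor3"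
  where "sum_rank_one r a b c = (\<lambda>p q s. \<Sum>l<r. a l p * b l q * c l s)"

text \<open>T (viewed in C^{n^2}(x)C^{n^2}(x)C^{n^2}) is a limit of sums of r rank one tensors.
  Convergence is coordinatewise, which is the Euclidean topology on this
  finite-dimensional space.\<close>
definition border_rank_le :: "nat \<Rightarrow> tensor3 \<Rightarrow> nat \<Rightarrow> bool" where
  "border_rank_le n T r \<longleftrightarrow>
     (\<exists>a b c :: nat \<Rightarrow> nat \<Rightarrow> idx \<Rightarrow> complex.
        \<forall>p\<in>mat_idx n. \<forall>q\<in>mat_idx n. \<forall>s\<in>mat_idx n.
          ((\<lambda>t. sum_rank_one r (a t) (b t) (c t) p q s) \<longlongrightarrow> T p q s) sequentially)"

definition border_rank :: "nat \<Rightarrow> tensor3 \<Rightarrow> nat" where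
  "border_rank n T = (LEAST r. border_rank_le n T r)"

end

theory Submission
  imports Defs "HOL-Computational_Algebra.Polynomial"
begin

text \<open>
  For \<open>n \<ge> 3\<close>, suppose that \<open>M\<close> is a limit of sums of \<open>2n\<^sup>2 - n\<close> rank one tensors. Border
  substitution, followed by a torus degeneration, makes \<open>M\<close> with one slice \<open>x\<^sup>i\<^sub>j\<close> deleted a limit
  of sums of \<open>2n\<^sup>2 - n - 1\<close> rank one tensors. Restrict the first factor to \<open>2n - 1\<close> rank one
  matrices \<open>u\<^sub>s v\<^sub>s\<^sup>T\<close> whose \<open>(i, j)\<close> entry vanishes and take the Koszul flattening
  \<open>\<Lambda>\<^sup>n\<^sup>-\<^sup>1 \<otimes> B\<^sup>* \<rightarrow> \<Lambda>\<^sup>n \<otimes> C\<close>, to which each rank one tensor contributes rank at most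
  \<open>2n - 2 choose n - 1\<close>. Any \<open>n\<close> of the \<open>v\<^sub>s\<close> are independent, and so are any \<open>n\<close> of the \<open>u\<^sub>s\<close>
  with one exception, so the kernel of the flattening has dimension at most \<open>n\<close>. This is smaller
  than \<open>2n - 2 choose n - 1\<close>, and a kernel vector that survives in the limit is a contradiction.

  For \<open>n = 2\<close> that argument falls short by one, and the proof uses border apolarity instead. If
  \<open>M\<close> is a limit of sums of six \<open>a\<^sub>l \<otimes> b\<^sub>l \<otimes> c\<^sub>l\<close>, let \<open>E\<close> be a limit of the spans of the
  \<open>a\<^sub>l \<otimes> b\<^sub>l\<close>. It contains \<open>M(C\<^sup>*)\<close>, and \<open>Q = E / M(C\<^sup>*)\<close> is a space of dimension at most two of
  forms of degree \<open>(1, 2, 1)\<close> in \<open>(u, v, w)\<close>. The limit of the spans of the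
  \<open>a\<^sub>l \<otimes> a\<^sub>l \<otimes> b\<^sub>l\<close> is a 6-dimensional prolongation of \<open>E\<close>, which forces
  \<open>Q = U \<cdot> P(v, w)\<close>; in the same way \<open>a\<^sub>l \<otimes> b\<^sub>l \<otimes> b\<^sub>l\<close> forces \<open>Q = W \<cdot> P'(u, v)\<close>.
  The two descriptions are incompatible.
\<close>

section \<open>Underdetermined systems and limits of subspaces\<close>

text \<open>Gaussian elimination, one equation at a time: equation \<open>i\<close> is solved for a
  pivot variable \<open>j0\<close>, and the induction hypothesis handles the other equations with
  the pivot column cleared.\<close>

lemma underdetermined_system_nontrivial:
  fixes A :: "'i \<Rightarrow> 'j \<Rightarrow> 'a::field"
  assumes "finite I" "finite J" "card I < card J"
  shows "\<exists>x. (\<exists>j\<in>J. x j \<noteq> 0) \<and> (\<forall>i\<in>I. (\<Sum>j\<in>J. A i j * x j) = 0)"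
  using assms
proof (induction I arbitrary: A J rule: finite_induct)
  case empty
  then have "J \<noteq> {}" by auto
  then show ?case by (intro exI[of _ "\<lambda>_. 1"]) auto
next
  case (insert i I)
  show ?case
  proof (cases "\<forall>j\<in>J. A i j = 0")
    case True
    have "card I < card J" using insert by simp
    then obtain x where "\<exists>j\<in>J. x j \<noteq> 0" "\<forall>i\<in>I. (\<Sum>j\<in>J. A i j * x j) = 0"
      using insert.IH[OF insert.prems(1), of A] by blast
    then show ?thesis using True by (intro exI[of _ x]) auto
  next
    case False
    then obtain j0 where j0: "j0 \<in> J" "A i j0 \<noteq> 0" by blast
    let ?J = "J - {j0}"
    have "card I < card ?J" using insert j0 by simp
    then obtain x where x: "\<exists>j\<in>?J. x j \<noteq> 0"
      "\<forall>i'\<in>I. (\<Sum>j\<in>?J. (A i' j - A i' j0 * A i j / A i j0) * x j) = 0"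
      using insert.IH[of ?J "\<lambda>i' j. A i' j - A i' j0 * A i j / A i j0"] insert.prems(1) by auto
    define y where "y = x(j0 := - (\<Sum>j\<in>?J. A i j * x j) / A i j0)"
    have sm: "(\<Sum>j\<in>J. A i' j * y j) =
        (\<Sum>j\<in>?J. A i' j * x j) - A i' j0 * (\<Sum>j\<in>?J. A i j * x j) / A i j0" for i'
    proof -
      have "(\<Sum>j\<in>J. A i' j * y j) = A i' j0 * y j0 + (\<Sum>j\<in>?J. A i' j * y j)"
        by (rule sum.remove) (use insert.prems j0 in auto)
      moreover have "(\<Sum>j\<in>?J. A i' j * y j) = (\<Sum>j\<in>?J. A i' j * x j)"
        by (rule sum.cong) (auto simp: y_def)
      ultimately show ?thesis by (simp add: y_def)
    qed
    have "(\<Sum>j\<in>J. A i' j * y j) = 0" if "i' \<in> I" for i'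
    proof -
      have "(\<Sum>j\<in>?J. (A i' j - A i' j0 * A i j / A i j0) * x j) =
          (\<Sum>j\<in>?J. A i' j * x j) - A i' j0 * (\<Sum>j\<in>?J. A i j * x j) / A i j0"
        by (simp add: sum_subtractf sum_distrib_left sum_divide_distrib algebra_simps)
      then show ?thesis using x(2) that sm by metis
    qed
    moreover have "(\<Sum>j\<in>J. A i j * y j) = 0" using sm[of i] j0 by simp
    moreover have "\<exists>j\<in>J. y j \<noteq> 0" using x(1) by (auto simp: y_def)
    ultimately show ?thesis by auto
  qed
qed

lemma bounded_finite_family_convergent_subsequence:
  fixes w :: "nat \<Rightarrow> 'i \<Rightarrow> complex"
  assumes "finite I" "\<And>t i. i \<in> I \<Longrightarrow> norm (w t i) \<le> B"
  shows "\<exists>\<phi> x. strict_mono \<phi> \<and> (\<forall>i\<in>I. (\<lambda>t. w (\<phi> t) i) \<longlonglongrightarrow> x i)"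
  using assms
proof (induction I rule: finite_induct)
  case empty
  then show ?case by (intro exI[of _ id]) (auto simp: strict_mono_def)
next
  case (insert i I)
  then obtain \<phi> x where \<phi>: "strict_mono \<phi>" "\<forall>i\<in>I. (\<lambda>t. w (\<phi> t) i) \<longlonglongrightarrow> x i"
    by (metis insertCI)
  have "bounded (range (\<lambda>t. w (\<phi> t) i))"
    using insert.prems by (auto simp: bounded_iff)
  then obtain l \<psi> where \<psi>: "strict_mono \<psi>" "((\<lambda>t. w (\<phi> t) i) \<circ> \<psi>) \<longlonglongrightarrow> l"
    using bounded_imp_convergent_subsequence by metis
  have "(\<lambda>t. w (\<phi> (\<psi> t)) j) \<longlonglongrightarrow> x j" if "j \<in> I" for j
    using LIMSEQ_subseq_LIMSEQ[OF \<phi>(2)[rule_format, OF that] \<psi>(1)] by (simp add: o_def)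
  then show ?case using \<phi>(1) \<psi> insert.hyps
    by (intro exI[of _ "\<phi> \<circ> \<psi>"] exI[of _ "x(i := l)"]) (auto simp: strict_mono_def o_def)
qed

text \<open>Compactness of projective space: dividing by the maximum norm bounds the vectors, and
  some coordinate keeps norm 1 at each \<open>t\<close>, so the limit cannot vanish.\<close>

lemma nonzero_vectors_rescaled_limit:
  fixes w :: "nat \<Rightarrow> 'i \<Rightarrow> complex"
  assumes "finite I" "\<And>t. \<exists>i\<in>I. w t i \<noteq> 0"
  obtains \<phi> \<kappa> x where "strict_mono \<phi>" "\<And>i. i \<in> I \<Longrightarrow> (\<lambda>t. \<kappa> t * w (\<phi> t) i) \<longlonglongrightarrow> x i"
    "\<exists>i\<in>I. x i \<noteq> 0"
proof -
  have ne: "I \<noteq> {}" using assms(2) by blast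
  define m where "m t = Max ((\<lambda>i. norm (w t i)) ` I)" for t
  have le: "norm (w t i) \<le> m t" if "i \<in> I" for t i
    using assms(1) that by (auto simp: m_def)
  have pos: "m t > 0" for t
    using assms(2)[of t] le[of _ t] by (metis norm_le_zero_iff not_le order_trans)
  have att: "\<exists>i\<in>I. norm (w t i) = m t" for t
  proof -
    have "m t \<in> (\<lambda>i. norm (w t i)) ` I"
      unfolding m_def by (rule Max_in) (use assms(1) ne in auto)
    then show ?thesis by auto
  qed
  define v where "v t i = complex_of_real (1 / m t) * w t i" for t i
  have "norm (v t i) \<le> 1" if "i \<in> I" for t i
    using le[OF that, of t] pos[of t] by (simp add: v_def norm_mult norm_divide)
  then obtain \<phi> x where \<phi>: "strict_mono \<phi>" "\<forall>i\<in>I. (\<lambda>t. v (\<phi> t) i) \<longlonglongrightarrow> x i"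
    using bounded_finite_family_convergent_subsequence[OF assms(1)] by metis
  have "\<exists>i\<in>I. x i \<noteq> 0"
  proof (rule ccontr)
    assume "\<not> ?thesis"
    then have "\<forall>i\<in>I. eventually (\<lambda>t. norm (v (\<phi> t) i) < 1) sequentially"
      using \<phi>(2) order_tendstoD(2)[OF tendsto_norm] by fastforce
    then have "eventually (\<lambda>t. \<forall>i\<in>I. norm (v (\<phi> t) i) < 1) sequentially"
      using assms(1) by (simp add: eventually_ball_finite_distrib)
    then obtain t where t: "\<forall>i\<in>I. norm (v (\<phi> t) i) < 1"
      by (auto simp: eventually_sequentially)
    obtain i where "i \<in> I" "norm (w (\<phi> t) i) = m (\<phi> t)" using att by blast
    then show False using t pos[of "\<phi> t"] by (auto simp: v_def norm_mult norm_divide)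
  qed
  then show ?thesis
    using that[of \<phi> "\<lambda>t. complex_of_real (1 / m (\<phi> t))" x] \<phi> by (simp add: v_def)
qed

section \<open>Approximation by sums with independent products\<close>

lemma finite_mat_idx [simp]: "finite (mat_idx n)"
  by (simp add: mat_idx_def)

text \<open>Border rank phrased by precision instead of by sequences, so that a single approximation
  can be perturbed or transformed.\<close>

definition approximable :: "nat \<Rightarrow> tensor3 \<Rightarrow> nat \<Rightarrow> bool" where
  "approximable n T r \<longleftrightarrow> (\<forall>e>0. \<exists>a b c. \<forall>p\<in>mat_idx n. \<forall>q\<in>mat_idx n. \<forall>s\<in>mat_idx n.
     norm (sum_rank_one r a b c p q s - T p q s) < e)"

lemma tensor_limit_close:
  assumes "\<And>p q s. \<lbrakk>p \<in> mat_idx n; q \<in> mat_idx n; s \<in> mat_idx n\<rbrakk> \<Longrightarrow> (\<lambda>t. U t p q s) \<longlonglongrightarrow> T p q s"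
    and "e > (0::real)"
  shows "\<exists>t. \<forall>p\<in>mat_idx n. \<forall>q\<in>mat_idx n. \<forall>s\<in>mat_idx n. norm (U t p q s - T p q s :: complex) < e"
proof -
  have "eventually (\<lambda>t. \<forall>p\<in>mat_idx n. \<forall>q\<in>mat_idx n. \<forall>s\<in>mat_idx n. norm (U t p q s - T p q s) < e) sequentially"
    using assms by (auto simp: eventually_ball_finite_distrib tendsto_iff dist_norm)
  then show ?thesis unfolding eventually_sequentially by blast
qed

lemma border_rank_le_imp_approximable:
  assumes "border_rank_le n T r"
  shows "approximable n T r"
proof -
  obtain a b c where lim: "\<And>p q s. \<lbrakk>p \<in> mat_idx n; q \<in> mat_idx n; s \<in> mat_idx n\<rbrakk> \<Longrightarrow>
      (\<lambda>t. sum_rank_one r (a t) (b t) (c t) p q s) \<longlonglongrightarrow> T p q s"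
    using assms unfolding border_rank_le_def by blast
  from tensor_limit_close[of n "\<lambda>t. sum_rank_one r (a t) (b t) (c t)" T, OF lim] show ?thesis
    unfolding approximable_def by blast
qed

lemma tendsto_if_inverse_Suc_bound:
  fixes l :: complex
  assumes "\<And>t. norm (x t - l) < inverse (real (Suc t))"
  shows "x \<longlonglongrightarrow> l"
  by (rule LIM_zero_cancel, rule Lim_null_comparison[OF _ LIMSEQ_inverse_real_of_nat])
    (use assms in \<open>auto intro: less_imp_le always_eventually\<close>)

definition independent_products :: "idx set \<Rightarrow> nat \<Rightarrow> (nat \<Rightarrow> idx \<Rightarrow> complex) \<Rightarrow> (nat \<Rightarrow> idx \<Rightarrow> complex) \<Rightarrow> bool" where
  "independent_products J r a b \<longleftrightarrow>
     (\<forall>x. (\<forall>p\<in>J. \<forall>q\<in>J. (\<Sum>l<r. x l * (a l p * b l q)) = 0) \<longrightarrow> (\<forall>l<r. x l = 0))"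

text \<open>Induction on the number of products: a nonzero bilinear form \<open>B\<close> with
  coefficients \<open>f\<close> vanishes on the products already built. The new pair only has to
  satisfy \<open>B x y \<noteq> 0\<close>, because applying \<open>B\<close> to a relation then
  kills its last coefficient.\<close>

lemma independent_products_dense:
  assumes "finite J" "r \<le> card J * card J" "e > 0"
  shows "\<exists>a' b'. (\<forall>l p. norm (a' l p - a l p) < e \<and> norm (b' l p - b l p) < e)
    \<and> independent_products J r a' b'"
  using assms(2)
proof (induction r)
  case 0
  then show ?case using assms(3)
    by (intro exI[of _ a] exI[of _ b]) (auto simp: independent_products_def)
next
  case (Suc r)
  then obtain a' b' where ab: "\<forall>l p. norm (a' l p - a l p) < e \<and> norm (b' l p - b l p) < e"
    "independent_products J r a' b'" by auto
  obtain f where f: "\<exists>z\<in>J \<times> J. f z \<noteq> 0"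
    "\<forall>l\<in>{..<r}. (\<Sum>z\<in>J \<times> J. a' l (fst z) * b' l (snd z) * f z) = 0"
    using underdetermined_system_nontrivial[of "{..<r}" "J \<times> J" "\<lambda>l z. a' l (fst z) * b' l (snd z)"]
      Suc.prems assms(1) by (auto simp: card_cartesian_product)
  then obtain p0 q0 where pq: "p0 \<in> J" "q0 \<in> J" "f (p0, q0) \<noteq> 0" by auto
  define B where "B x y = (\<Sum>z\<in>J \<times> J. x (fst z) * y (snd z) * f z)" for x y :: "idx \<Rightarrow> complex"
  define \<delta> :: complex where "\<delta> = of_real (e / 2)"
  have \<delta>: "norm \<delta> < e" "\<delta> \<noteq> 0" using assms(3) by (auto simp: \<delta>_def)
  define A where "A = (a r)(p0 := a r p0 + \<delta>)"
  define C where "C = (b r)(q0 := b r q0 + \<delta>)"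
  \<comment> \<open>The mixed second difference of \<open>B\<close> in the directions
    \<open>p0\<close> and \<open>q0\<close> is \<open>\<delta> * \<delta> * f (p0, q0)\<close>, so
    \<open>B\<close> is nonzero at one of the four corners.\<close>
  have "B A C - B A (b r) - B (a r) C + B (a r) (b r)
      = (\<Sum>z\<in>J \<times> J. (A (fst z) - a r (fst z)) * (C (snd z) - b r (snd z)) * f z)"
    unfolding B_def sum_subtractf[symmetric] sum.distrib[symmetric]
    by (rule sum.cong) (auto simp: algebra_simps)
  also have "\<dots> = (\<Sum>z\<in>{(p0, q0)}. (A (fst z) - a r (fst z)) * (C (snd z) - b r (snd z)) * f z)"
    by (rule sum.mono_neutral_right) (use assms(1) pq in \<open>auto simp: A_def C_def split: if_splits\<close>)
  also have "\<dots> \<noteq> 0" using pq \<delta> by (simp add: A_def C_def)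
  finally have "B A C \<noteq> 0 \<or> B A (b r) \<noteq> 0 \<or> B (a r) C \<noteq> 0 \<or> B (a r) (b r) \<noteq> 0" by auto
  moreover have "\<forall>p. norm (A p - a r p) < e" "\<forall>p. norm (C p - b r p) < e"
    using \<delta> assms(3) by (auto simp: A_def C_def)
  ultimately obtain x y where xy: "B x y \<noteq> 0" "\<forall>p. norm (x p - a r p) < e" "\<forall>p. norm (y p - b r p) < e"
    using assms(3) by (metis diff_self norm_zero)
  have "independent_products J (Suc r) (a'(r := x)) (b'(r := y))"
    unfolding independent_products_def
  proof (intro allI impI)
    fix \<xi> :: "nat \<Rightarrow> complex" and l
    assume h: "\<forall>p\<in>J. \<forall>q\<in>J. (\<Sum>l<Suc r. \<xi> l * ((a'(r := x)) l p * (b'(r := y)) l q)) = 0" and l: "l < Suc r"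
    have e: "(\<Sum>l<r. \<xi> l * (a' l p * b' l q)) + \<xi> r * (x p * y q) = 0" if "p \<in> J" "q \<in> J" for p q
      using h that by simp
    have "0 = (\<Sum>z\<in>J \<times> J. ((\<Sum>l<r. \<xi> l * (a' l (fst z) * b' l (snd z))) + \<xi> r * (x (fst z) * y (snd z))) * f z)"
      by (rule sum.neutral [symmetric]) (use e in auto)
    also have "\<dots> = (\<Sum>z\<in>J \<times> J. \<Sum>l<r. \<xi> l * (a' l (fst z) * b' l (snd z) * f z)) + \<xi> r * B x y"
      by (simp add: B_def sum.distrib sum_distrib_left sum_distrib_right algebra_simps)
    also have "(\<Sum>z\<in>J \<times> J. \<Sum>l<r. \<xi> l * (a' l (fst z) * b' l (snd z) * f z))
        = (\<Sum>l<r. \<xi> l * (\<Sum>z\<in>J \<times> J. a' l (fst z) * b' l (snd z) * f z))"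
      by (subst sum.swap) (simp add: sum_distrib_left)
    also have "\<dots> = 0" using f(2) by simp
    finally have r0: "\<xi> r = 0" using xy(1) by simp
    then have "\<forall>l<r. \<xi> l = 0" using ab(2) e unfolding independent_products_def by simp
    then show "\<xi> l = 0" using l r0 by (auto simp: less_Suc_eq)
  qed
  moreover have "\<forall>l p. norm ((a'(r := x)) l p - a l p) < e \<and> norm ((b'(r := y)) l p - b l p) < e"
    using ab(1) xy by simp
  ultimately show ?case by blast
qed

lemma approximable_independent:
  assumes ap: "approximable n T r" and r: "r \<le> card (mat_idx n) * card (mat_idx n)" and e: "e > 0"
  shows "\<exists>a b c. (\<forall>p\<in>mat_idx n. \<forall>q\<in>mat_idx n. \<forall>s\<in>mat_idx n.
     norm (sum_rank_one r a b c p q s - T p q s) < e) \<and> independent_products (mat_idx n) r a b"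
proof -
  obtain a b c where abc: "\<forall>p\<in>mat_idx n. \<forall>q\<in>mat_idx n. \<forall>s\<in>mat_idx n.
     norm (sum_rank_one r a b c p q s - T p q s) < e / 2"
    using ap e unfolding approximable_def by (metis half_gt_zero)
  have "\<exists>a' b'. (\<forall>l p. norm (a' l p - a l p) < inverse (real (Suc t)) \<and> norm (b' l p - b l p) < inverse (real (Suc t)))
    \<and> independent_products (mat_idx n) r a' b'" for t
    by (rule independent_products_dense) (use r in auto)
  then obtain A B where AB: "\<And>t l p. norm (A t l p - a l p) < inverse (real (Suc t))"
    "\<And>t l p. norm (B t l p - b l p) < inverse (real (Suc t))"
    "\<And>t. independent_products (mat_idx n) r (A t) (B t)"
    by metis
  have "(\<lambda>t. sum_rank_one r (A t) (B t) c p q s) \<longlonglongrightarrow> sum_rank_one r a b c p q s" for p q s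
    unfolding sum_rank_one_def
    by (intro tendsto_intros tendsto_if_inverse_Suc_bound AB)
  then obtain t where t: "\<forall>p\<in>mat_idx n. \<forall>q\<in>mat_idx n. \<forall>s\<in>mat_idx n.
      norm (sum_rank_one r (A t) (B t) c p q s - sum_rank_one r a b c p q s) < e / 2"
    using tensor_limit_close[of n "\<lambda>t. sum_rank_one r (A t) (B t) c" "sum_rank_one r a b c" "e / 2"] e by auto
  have "norm (sum_rank_one r (A t) (B t) c p q s - T p q s) < e"
    if "p \<in> mat_idx n" "q \<in> mat_idx n" "s \<in> mat_idx n" for p q s
    by (rule norm_diff_triangle_less[of _ "sum_rank_one r a b c p q s" "e / 2" _ "e / 2", simplified])
      (use t abc that in auto)
  then show ?thesis using AB(3) by blast
qed

text \<open>For fixed \<open>p\<close> the numbers \<open>x l * a l p\<close> form a relation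
  between the products, hence vanish. A nonzero \<open>x l\<close> would force \<open>a l\<close> to
  vanish on \<open>J\<close>, but a zero product cannot belong to an independent family.\<close>

lemma independent_squares:
  assumes "independent_products J r a b"
    and "\<And>p p' q. \<lbrakk>p \<in> J; p' \<in> J; q \<in> J\<rbrakk> \<Longrightarrow> (\<Sum>l<r. x l * (a l p * a l p' * b l q)) = 0"
  shows "\<forall>l<r. x l = 0"
proof (intro allI impI, rule ccontr)
  fix l assume l: "l < r" "x l \<noteq> 0"
  have "\<forall>l<r. x l * a l p = 0" if "p \<in> J" for p
  proof -
    have "(\<Sum>l<r. (x l * a l p) * (a l p' * b l q)) = 0" if "p' \<in> J" "q \<in> J" for p' q
      using assms(2)[OF \<open>p \<in> J\<close> that] by (simp add: mult.assoc)
    then show ?thesis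
      using assms(1)[unfolded independent_products_def, rule_format, of "\<lambda>l. x l * a l p"] by blast
  qed
  then have "a l p = 0" if "p \<in> J" for p using l that by (metis mult_eq_0_iff)
  then have "\<forall>p\<in>J. \<forall>q\<in>J. (\<Sum>l'<r. (if l' = l then 1 else 0) * (a l' p * b l' q)) = 0"
    by (auto intro!: sum.neutral)
  with assms(1)[unfolded independent_products_def, rule_format, of "\<lambda>l'. if l' = l then 1 else 0" l] l(1)
  show False by simp
qed

lemma independent_products_commute:
  assumes "independent_products J r a b"
  shows "independent_products J r b a"
  unfolding independent_products_def
proof (intro allI impI)
  fix x l assume "\<forall>p\<in>J. \<forall>q\<in>J. (\<Sum>l<r. x l * (b l p * a l q)) = 0" "l < r"
  then show "x l = 0"
    using assms unfolding independent_products_def by (simp add: mult.commute[of "b _ _"])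
qed

section \<open>Compactness of Grassmannians\<close>

lemma limit_of_independent_families_aux:
  fixes v :: "nat \<Rightarrow> nat \<Rightarrow> 'i \<Rightarrow> complex"
  assumes I: "finite I"
    and indep: "\<forall>t x. (\<forall>i\<in>I. (\<Sum>l<d. x l * v t l i) = 0) \<longrightarrow> (\<forall>l<d. x l = 0)"
    and "m \<le> d"
  shows "\<exists>\<phi> \<kappa> w. strict_mono \<phi> \<and>
    (\<forall>g<m. \<forall>i\<in>I. (\<lambda>t. \<Sum>l<d. \<kappa> t g l * v (\<phi> t) l i) \<longlonglongrightarrow> w g i) \<and>
    (\<forall>g<m. \<exists>i\<in>I. w g i \<noteq> 0) \<and> (\<forall>g<m. \<forall>g'<g. (\<Sum>i\<in>I. w g i * cnj (w g' i)) = 0)"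
  using assms(3)
proof (induction m)
  case 0
  then show ?case by (intro exI[of _ id]) (auto simp: strict_mono_def)
next
  case (Suc m)
  from Suc.IH[OF Suc_leD[OF Suc.prems]] obtain \<phi> \<kappa> w where IH: "strict_mono \<phi> \<and>
    (\<forall>g<m. \<forall>i\<in>I. (\<lambda>t. \<Sum>l<d. \<kappa> t g l * v (\<phi> t) l i) \<longlonglongrightarrow> w g i) \<and>
    (\<forall>g<m. \<exists>i\<in>I. w g i \<noteq> 0) \<and> (\<forall>g<m. \<forall>g'<g. (\<Sum>i\<in>I. w g i * cnj (w g' i)) = 0)"
    by (elim exE)
  note \<phi> = IH[THEN conjunct1]
    and lim = IH[THEN conjunct2, THEN conjunct1, rule_format]
    and nz = IH[THEN conjunct2, THEN conjunct2, THEN conjunct1, rule_format]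
    and orth = IH[THEN conjunct2, THEN conjunct2, THEN conjunct2, rule_format]
  \<comment> \<open>Gram-Schmidt in the limit: \<open>m < d\<close> orthogonality conditions leave a
    nonzero vector of the \<open>t\<close>-th span orthogonal to the limits \<open>w g\<close> found
    so far. Orthogonality passes to the rescaled limit, so no dimension is lost.\<close>
  have ex: "\<forall>t. \<exists>y. (\<exists>l\<in>{..<d}. y l \<noteq> 0) \<and>
      (\<forall>g\<in>{..<m}. (\<Sum>l<d. (\<Sum>i\<in>I. v (\<phi> t) l i * cnj (w g i)) * y l) = 0)"
    by (intro allI underdetermined_system_nontrivial) (use Suc.prems in auto)
  from choice[OF ex] obtain y where ys: "\<forall>t. (\<exists>l\<in>{..<d}. y t l \<noteq> 0) \<and>
      (\<forall>g\<in>{..<m}. (\<Sum>l<d. (\<Sum>i\<in>I. v (\<phi> t) l i * cnj (w g i)) * y t l) = 0)"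
    by (elim exE)
  note y = ys[rule_format, THEN conjunct1] ys[rule_format, THEN conjunct2, rule_format]
  define u where "u t i = (\<Sum>l<d. y t l * v (\<phi> t) l i)" for t i
  have unz: "\<exists>i\<in>I. u t i \<noteq> 0" for t
    using indep[rule_format, of "y t" "\<phi> t"] y(1)[of t] by (auto simp: u_def)
  obtain \<psi> \<rho> x where \<psi>: "strict_mono \<psi>"
    and ux: "\<And>i. i \<in> I \<Longrightarrow> (\<lambda>t. \<rho> t * u (\<psi> t) i) \<longlonglongrightarrow> x i" and xnz: "\<exists>i\<in>I. x i \<noteq> 0"
    using nonzero_vectors_rescaled_limit[of I u, OF I unz] by blast
  have uorth: "(\<Sum>i\<in>I. u t i * cnj (w g i)) = 0" if "g < m" for t g
  proof -
    have "(\<Sum>i\<in>I. u t i * cnj (w g i)) = (\<Sum>l<d. (\<Sum>i\<in>I. v (\<phi> t) l i * cnj (w g i)) * y t l)"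
      unfolding u_def sum_distrib_right by (subst sum.swap) (simp add: mult_ac)
    then show ?thesis using y(2)[of g] that by simp
  qed
  have xorth: "(\<Sum>i\<in>I. x i * cnj (w g i)) = 0" if "g < m" for g
  proof -
    have "(\<lambda>t. \<Sum>i\<in>I. \<rho> t * u (\<psi> t) i * cnj (w g i)) \<longlonglongrightarrow> (\<Sum>i\<in>I. x i * cnj (w g i))"
      by (intro tendsto_intros ux)
    moreover have "(\<Sum>i\<in>I. \<rho> t * u (\<psi> t) i * cnj (w g i)) = 0" for t
      using uorth[OF that, of "\<psi> t"] by (simp add: mult.assoc flip: sum_distrib_left)
    ultimately show ?thesis by (simp add: LIMSEQ_const_iff)
  qed
  define \<kappa>' where "\<kappa>' t g l = (if g = m then \<rho> t * y (\<psi> t) l else \<kappa> (\<psi> t) g l)" for t g l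
  have "(\<lambda>t. \<Sum>l<d. \<kappa>' t g l * v ((\<phi> \<circ> \<psi>) t) l i) \<longlonglongrightarrow> (w(m := x)) g i" if "g < Suc m" "i \<in> I" for g i
  proof (cases "g = m")
    case True
    have "(\<Sum>l<d. \<kappa>' t g l * v ((\<phi> \<circ> \<psi>) t) l i) = \<rho> t * u (\<psi> t) i" for t
      by (simp add: u_def \<kappa>'_def True sum_distrib_left mult.assoc)
    then show ?thesis using ux[OF that(2)] True by simp
  next
    case False
    then have "g < m" using that by simp
    from LIMSEQ_subseq_LIMSEQ[OF lim[OF this that(2)] \<psi>] show ?thesis
      using False by (simp add: o_def \<kappa>'_def)
  qed
  moreover have "strict_mono (\<phi> \<circ> \<psi>)" using \<phi> \<psi> by (simp add: strict_mono_def)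
  moreover have "\<exists>i\<in>I. (w(m := x)) g i \<noteq> 0" if "g < Suc m" for g
    using nz xnz that by (cases "g = m") auto
  moreover have "(\<Sum>i\<in>I. (w(m := x)) g i * cnj ((w(m := x)) g' i)) = 0" if "g < Suc m" "g' < g" for g g'
    using that orth[of g g'] xorth[of g'] by (cases "g = m") auto
  ultimately show ?case by blast
qed

lemma limit_of_independent_families:
  fixes v :: "nat \<Rightarrow> nat \<Rightarrow> 'i \<Rightarrow> complex"
  assumes I: "finite I"
    and indep: "\<forall>t x. (\<forall>i\<in>I. (\<Sum>l<d. x l * v t l i) = 0) \<longrightarrow> (\<forall>l<d. x l = 0)"
  shows "\<exists>\<phi> \<kappa> w. strict_mono \<phi> \<and>
    (\<forall>g<d. \<forall>i\<in>I. (\<lambda>t. \<Sum>l<d. \<kappa> t g l * v (\<phi> t) l i) \<longlonglongrightarrow> w g i) \<and>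
    (\<forall>x. (\<forall>i\<in>I. (\<Sum>g<d. x g * w g i) = 0) \<longrightarrow> (\<forall>g<d. x g = 0))"
proof -
  from limit_of_independent_families_aux[where v = v, OF I indep order_refl]
  obtain \<phi> \<kappa> w where IH: "strict_mono \<phi> \<and>
    (\<forall>g<d. \<forall>i\<in>I. (\<lambda>t. \<Sum>l<d. \<kappa> t g l * v (\<phi> t) l i) \<longlonglongrightarrow> w g i) \<and>
    (\<forall>g<d. \<exists>i\<in>I. w g i \<noteq> 0) \<and> (\<forall>g<d. \<forall>g'<g. (\<Sum>i\<in>I. w g i * cnj (w g' i)) = 0)"
    by (elim exE)
  note \<phi> = IH[THEN conjunct1]
    and lim = IH[THEN conjunct2, THEN conjunct1, rule_format]
    and nz = IH[THEN conjunct2, THEN conjunct2, THEN conjunct1, rule_format]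
    and orth = IH[THEN conjunct2, THEN conjunct2, THEN conjunct2, rule_format]
  have orth': "(\<Sum>i\<in>I. w g i * cnj (w g' i)) = 0" if "g < d" "g' < d" "g \<noteq> g'" for g g'
  proof (cases "g' < g")
    case False
    then have "(\<Sum>i\<in>I. w g' i * cnj (w g i)) = 0" using orth that by simp
    from arg_cong[OF this, of cnj] show ?thesis by (simp add: mult.commute)
  qed (use orth that in auto)
  have "\<forall>g<d. x g = 0" if x: "\<forall>i\<in>I. (\<Sum>g<d. x g * w g i) = 0" for x
  proof (intro allI impI)
    fix g assume g: "g < d"
    have "0 = (\<Sum>i\<in>I. (\<Sum>g'<d. x g' * w g' i) * cnj (w g i))" using x by simp
    also have "\<dots> = (\<Sum>g'<d. x g' * (\<Sum>i\<in>I. w g' i * cnj (w g i)))"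
      unfolding sum_distrib_left sum_distrib_right by (subst sum.swap) (simp add: mult.assoc)
    also have "\<dots> = (\<Sum>g'\<in>{g}. x g' * (\<Sum>i\<in>I. w g' i * cnj (w g i)))"
      by (rule sum.mono_neutral_right) (use g orth' in auto)
    also have "\<dots> = x g * of_real (\<Sum>i\<in>I. (norm (w g i))\<^sup>2)"
      by (simp add: complex_norm_square del: of_real_power)
    finally have z: "x g * of_real (\<Sum>i\<in>I. (norm (w g i))\<^sup>2) = 0" by simp
    obtain i where "i \<in> I" "w g i \<noteq> 0" using nz[OF g] by blast
    then have "(\<Sum>i\<in>I. (norm (w g i))\<^sup>2) > 0" using I by (intro sum_pos2[of _ i]) auto
    then show "x g = 0" using z unfolding mult_eq_0_iff of_real_eq_0_iff by simp
  qed
  then show ?thesis using \<phi> lim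
    by (intro exI[of _ \<phi>] exI[of _ \<kappa>] exI[of _ w]) simp
qed

text \<open>Semicontinuity of dimension: for each \<open>t\<close> the \<open>N\<close> coefficient
  vectors \<open>\<xi> g t\<close> have length \<open>d < N\<close> and satisfy a relation, whose
  rescaled limit is a nonzero relation between the limits.\<close>

lemma limits_of_span_dependent:
  fixes v :: "nat \<Rightarrow> nat \<Rightarrow> 'i \<Rightarrow> complex"
  assumes lim: "\<And>g i. \<lbrakk>g < N; i \<in> I\<rbrakk> \<Longrightarrow> (\<lambda>t. \<Sum>l<d. \<xi> g t l * v t l i) \<longlonglongrightarrow> e g i"
    and "d < N"
  shows "\<exists>x. (\<exists>g<N. x g \<noteq> 0) \<and> (\<forall>i\<in>I. (\<Sum>g<N. x g * e g i) = 0)"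
proof -
  have "\<exists>y. (\<exists>g\<in>{..<N}. y g \<noteq> 0) \<and> (\<forall>l\<in>{..<d}. (\<Sum>g<N. \<xi> g t l * y g) = 0)" for t
    by (rule underdetermined_system_nontrivial) (use assms(2) in auto)
  then obtain y where y: "\<And>t. \<exists>g\<in>{..<N}. y t g \<noteq> 0" "\<And>t l. l < d \<Longrightarrow> (\<Sum>g<N. \<xi> g t l * y t g) = 0"
    by (metis lessThan_iff)
  obtain \<psi> \<rho> x where \<psi>: "strict_mono \<psi>"
    and yx: "\<And>g. g \<in> {..<N} \<Longrightarrow> (\<lambda>t. \<rho> t * y (\<psi> t) g) \<longlonglongrightarrow> x g" and xnz: "\<exists>g\<in>{..<N}. x g \<noteq> 0"
    using nonzero_vectors_rescaled_limit[of "{..<N}" y, OF finite_lessThan y(1)] by blast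
  have "(\<Sum>g<N. x g * e g i) = 0" if "i \<in> I" for i
  proof -
    have "(\<lambda>t. \<Sum>g<N. (\<rho> t * y (\<psi> t) g) * (\<Sum>l<d. \<xi> g (\<psi> t) l * v (\<psi> t) l i)) \<longlonglongrightarrow> (\<Sum>g<N. x g * e g i)"
      by (intro tendsto_intros yx LIMSEQ_subseq_LIMSEQ[OF lim \<psi>, unfolded o_def]) (use that in auto)
    moreover have "(\<Sum>g<N. (\<rho> t * y (\<psi> t) g) * (\<Sum>l<d. \<xi> g (\<psi> t) l * v (\<psi> t) l i)) = 0" for t
    proof -
      have "(\<Sum>g<N. (\<rho> t * y (\<psi> t) g) * (\<Sum>l<d. \<xi> g (\<psi> t) l * v (\<psi> t) l i))
        = (\<Sum>l<d. \<rho> t * v (\<psi> t) l i * (\<Sum>g<N. \<xi> g (\<psi> t) l * y (\<psi> t) g))"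
        unfolding sum_distrib_left by (subst sum.swap) (simp add: mult_ac)
      then show ?thesis using y(2) by simp
    qed
    ultimately show ?thesis by (simp add: LIMSEQ_const_iff)
  qed
  then show ?thesis using xnz by auto
qed

text \<open>Dimension at most two, for a mere set of functions: a nonzero \<open>z0\<close> and a
  \<open>z1\<close> not proportional to it generate, with zero functions as defaults in the
  degenerate cases.\<close>

lemma two_generators:
  fixes Z :: "('x \<Rightarrow> complex) set"
  assumes dep: "\<And>z0 z1 z2. \<lbrakk>z0 \<in> Z; z1 \<in> Z; z2 \<in> Z\<rbrakk> \<Longrightarrow>
    \<exists>c0 c1 c2. (c0 \<noteq> 0 \<or> c1 \<noteq> 0 \<or> c2 \<noteq> 0) \<and> (\<forall>i\<in>X. c0 * z0 i + c1 * z1 i + c2 * z2 i = 0)"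
  shows "\<exists>f0 f1. \<forall>z\<in>Z. \<exists>c0 c1. \<forall>i\<in>X. z i = c0 * f0 i + c1 * f1 i"
proof (cases "\<exists>z0\<in>Z. \<exists>i\<in>X. z0 i \<noteq> 0")
  case False
  then show ?thesis by (intro exI[of _ "\<lambda>_. 0"]) simp
next
  case True
  then obtain z0 i0 where z0: "z0 \<in> Z" "i0 \<in> X" "z0 i0 \<noteq> 0" by blast
  show ?thesis
  proof (cases "\<forall>z\<in>Z. \<exists>c. \<forall>i\<in>X. z i = c * z0 i")
    case True
    then show ?thesis
      by (intro exI[of _ z0] exI[of _ "\<lambda>_. 0"]) simp
  next
    case False
    then obtain z1 where z1: "z1 \<in> Z" "\<And>c. \<exists>i\<in>X. z1 i \<noteq> c * z0 i" by blast
    have "\<exists>c0 c1. \<forall>i\<in>X. z i = c0 * z0 i + c1 * z1 i" if z: "z \<in> Z" for z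
    proof -
      obtain c0 c1 c2 where c: "c0 \<noteq> 0 \<or> c1 \<noteq> 0 \<or> c2 \<noteq> 0"
        "\<And>i. i \<in> X \<Longrightarrow> c0 * z0 i + c1 * z1 i + c2 * z i = 0"
        using dep[OF z0(1) z1(1) z] by blast
      have c2: "c2 \<noteq> 0"
      proof
        assume c2: "c2 = 0"
        have "c1 \<noteq> 0" using c(1) c(2)[OF z0(2)] z0(3) c2 by auto
        then have "z1 i = (- c0 / c1) * z0 i" if "i \<in> X" for i
          using c(2)[OF that] c2 by (simp add: field_simps add_eq_0_iff)
        then show False using z1(2) by blast
      qed
      have "z i = (- c0 / c2) * z0 i + (- c1 / c2) * z1 i" if "i \<in> X" for i
      proof -
        have "c2 * z i = - (c0 * z0 i) - c1 * z1 i" using c(2)[OF that] by (simp add: algebra_simps add_eq_0_iff)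
        then show ?thesis using c2 by (simp add: field_simps)
      qed
      then show ?thesis by blast
    qed
    then show ?thesis by blast
  qed
qed

section \<open>Border apolarity for two by two matrices\<close>

text \<open>An element of \<open>A \<otimes> B\<close> is a multilinear form \<open>e(u, v, v', w)\<close>, where the index
  \<open>j'\<close> of the second factor is dualised by \<open>v' \<mapsto> (- v'\<^sub>1, v'\<^sub>0)\<close>. The coefficients
  below are those of \<open>e(u, v, v, w)\<close>, of degree 2 in \<open>v\<close>; the kernel of this restriction
  is exactly the image of the dual of \<open>C\<close> under the matrix multiplication tensor.\<close>
definition diag_restriction :: "(idx \<Rightarrow> idx \<Rightarrow> complex) \<Rightarrow> nat \<Rightarrow> nat \<Rightarrow> nat \<Rightarrow> complex" where
  "diag_restriction e i m k =
     (if m = 0 then e (i, 0) (1, k)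
      else if m = 1 then e (i, 1) (1, k) - e (i, 0) (0, k)
      else - e (i, 1) (0, k))"

lemma diag_restriction_sum:
  "diag_restriction (\<lambda>p q. \<Sum>g\<in>A. x g * e g p q) i m k
    = (\<Sum>g\<in>A. x g * diag_restriction (e g) i m k)"
  by (simp add: diag_restriction_def sum_subtractf right_diff_distrib sum_negf)

lemma less_3_cases: "(m::nat) < 3 \<Longrightarrow> m = 0 \<or> m = 1 \<or> m = 2"
  by linarith

lemma sum_lessThan_2: "(\<Sum>s<2::nat. g s) = g 0 + g 1"
  by (simp add: numeral_2_eq_2)

text \<open>\<open>p\<close> and \<open>q\<close> are quadratic forms in \<open>v0, v1\<close>, with
  \<open>m\<close> the exponent of \<open>v1\<close>. The hypotheses read
  \<open>(\<alpha> v0 + \<beta> v1) p + \<gamma> v0 q = 0\<close> and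
  \<open>(\<alpha>' v0 + \<beta>' v1) p + \<gamma>' v1 q = 0\<close>, where \<open>\<gamma>\<close>
  and \<open>\<gamma>'\<close> are nonzero because \<open>p\<close> is. If
  \<open>\<beta> = 0\<close> or \<open>\<alpha>' = 0\<close>, proportionality follows; otherwise
  both variables divide \<open>p\<close>, and comparing coefficients gives
  \<open>p = 0\<close>.\<close>

lemma proportional_if_shifts_dependent:
  fixes p q :: "nat \<Rightarrow> nat \<Rightarrow> complex"
  assumes ne: "m0 < 3" "k0 < 2" "p m0 k0 \<noteq> 0"
    and dep0: "\<exists>\<alpha> \<beta> \<gamma>. (\<alpha> \<noteq> 0 \<or> \<beta> \<noteq> 0 \<or> \<gamma> \<noteq> 0) \<and>
      (\<forall>k<2. \<alpha> * p 0 k + \<gamma> * q 0 k = 0 \<and> \<alpha> * p 1 k + \<beta> * p 0 k + \<gamma> * q 1 k = 0 \<and>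
        \<alpha> * p 2 k + \<beta> * p 1 k + \<gamma> * q 2 k = 0 \<and> \<beta> * p 2 k = 0)"
    and dep1: "\<exists>\<alpha> \<beta> \<gamma>. (\<alpha> \<noteq> 0 \<or> \<beta> \<noteq> 0 \<or> \<gamma> \<noteq> 0) \<and>
      (\<forall>k<2. \<alpha> * p 0 k = 0 \<and> \<alpha> * p 1 k + \<beta> * p 0 k + \<gamma> * q 0 k = 0 \<and>
        \<alpha> * p 2 k + \<beta> * p 1 k + \<gamma> * q 1 k = 0 \<and> \<beta> * p 2 k + \<gamma> * q 2 k = 0)"
  shows "\<exists>c. \<forall>m<3. \<forall>k<2. q m k = c * p m k"
proof -
  have nz: "p 0 k0 \<noteq> 0 \<or> p 1 k0 \<noteq> 0 \<or> p 2 k0 \<noteq> 0"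
    using ne less_3_cases by blast
  obtain \<alpha> \<beta> \<gamma> where a: "\<alpha> \<noteq> 0 \<or> \<beta> \<noteq> 0 \<or> \<gamma> \<noteq> 0"
    and e: "\<And>k. k < 2 \<Longrightarrow> \<alpha> * p 0 k + \<gamma> * q 0 k = 0"
      "\<And>k. k < 2 \<Longrightarrow> \<alpha> * p 1 k + \<beta> * p 0 k + \<gamma> * q 1 k = 0"
      "\<And>k. k < 2 \<Longrightarrow> \<alpha> * p 2 k + \<beta> * p 1 k + \<gamma> * q 2 k = 0"
      "\<And>k. k < 2 \<Longrightarrow> \<beta> * p 2 k = 0"
    using dep0 by blast
  obtain \<alpha>' \<beta>' \<gamma>' where a': "\<alpha>' \<noteq> 0 \<or> \<beta>' \<noteq> 0 \<or> \<gamma>' \<noteq> 0"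
    and e': "\<And>k. k < 2 \<Longrightarrow> \<alpha>' * p 0 k = 0"
      "\<And>k. k < 2 \<Longrightarrow> \<alpha>' * p 1 k + \<beta>' * p 0 k + \<gamma>' * q 0 k = 0"
      "\<And>k. k < 2 \<Longrightarrow> \<alpha>' * p 2 k + \<beta>' * p 1 k + \<gamma>' * q 1 k = 0"
      "\<And>k. k < 2 \<Longrightarrow> \<beta>' * p 2 k + \<gamma>' * q 2 k = 0"
    using dep1 by blast
  have g: "\<gamma> \<noteq> 0"
  proof
    assume "\<gamma> = 0"
    then show False using a e[of k0] ne(2) nz by auto
  qed
  have g': "\<gamma>' \<noteq> 0"
  proof
    assume "\<gamma>' = 0"
    then show False using a' e'[of k0] ne(2) nz by auto
  qed
  consider "\<beta> = 0" | "\<alpha>' = 0" | "\<beta> \<noteq> 0" "\<alpha>' \<noteq> 0" by blast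
  then show ?thesis
  proof cases
    case 1
    have "q m k = (- \<alpha> / \<gamma>) * p m k" if "m < 3" "k < 2" for m k
    proof -
      have "\<alpha> * p m k + \<gamma> * q m k = 0" using that e[of k] 1 less_3_cases[of m] by auto
      then show ?thesis using g by (simp add: field_simps add_eq_0_iff)
    qed
    then show ?thesis by blast
  next
    case 2
    have "q m k = (- \<beta>' / \<gamma>') * p m k" if "m < 3" "k < 2" for m k
    proof -
      have "\<beta>' * p m k + \<gamma>' * q m k = 0" using that e'[of k] 2 less_3_cases[of m] by auto
      then show ?thesis using g' by (simp add: field_simps add_eq_0_iff)
    qed
    then show ?thesis by blast
  next
    case 3
    have "p 0 k0 = 0" "p 2 k0 = 0" using e'(1)[of k0] e(4)[of k0] 3 ne(2) by auto
    moreover have "p 1 k0 = 0"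
      using e(1)[of k0] e'(2)[of k0] 3 ne(2) g calculation by auto
    ultimately show ?thesis using nz by blast
  qed
qed

text \<open>\<open>G\<close> is a 6-dimensional space of tensors in \<open>S\<^sup>2 A \<otimes> B\<close> whose contractions with the
  dual of \<open>A\<close> restrict to the span of \<open>f 0\<close> and \<open>f 1\<close>; \<open>h\<close> holds the coordinates.\<close>
locale limit_prolongation =
  fixes G :: "nat \<Rightarrow> tensor3" and h :: "nat \<Rightarrow> nat \<Rightarrow> idx \<Rightarrow> complex"
    and f :: "nat \<Rightarrow> nat \<Rightarrow> nat \<Rightarrow> nat \<Rightarrow> complex"
  assumes sym: "\<And>g p p' q. \<lbrakk>g < 6; p \<in> mat_idx 2; p' \<in> mat_idx 2; q \<in> mat_idx 2\<rbrakk>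
      \<Longrightarrow> G g p p' q = G g p' p q"
    and res: "\<And>g p i m k. \<lbrakk>g < 6; p \<in> mat_idx 2; i < 2; m < 3; k < 2\<rbrakk>
      \<Longrightarrow> diag_restriction (G g p) i m k = (\<Sum>s<2. h g s p * f s i m k)"
    and indep: "\<And>x. (\<And>p p' q. \<lbrakk>p \<in> mat_idx 2; p' \<in> mat_idx 2; q \<in> mat_idx 2\<rbrakk>
      \<Longrightarrow> (\<Sum>g<6. x g * G g p p' q) = 0) \<Longrightarrow> \<forall>g<6. x g = 0"
begin

lemma comb_res:
  assumes "p \<in> mat_idx 2" "i < 2" "m < 3" "k < 2"
  shows "diag_restriction (\<lambda>p' q. \<Sum>g<6. x g * G g p p' q) i m k
    = (\<Sum>s<2. (\<Sum>g<6. x g * h g s p) * f s i m k)"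
proof -
  have "diag_restriction (\<lambda>p' q. \<Sum>g<6. x g * G g p p' q) i m k
      = (\<Sum>g<6. x g * (\<Sum>s<2. h g s p * f s i m k))"
    unfolding diag_restriction_sum by (rule sum.cong) (use res assms in auto)
  also have "\<dots> = (\<Sum>s<2. (\<Sum>g<6. x g * h g s p) * f s i m k)"
    unfolding sum_distrib_left sum_distrib_right
    by (subst sum.swap) (simp add: mult.assoc)
  finally show ?thesis .
qed

lemma comb_sym:
  assumes "p \<in> mat_idx 2" "p' \<in> mat_idx 2" "q \<in> mat_idx 2"
  shows "(\<Sum>g<6. x g * G g p p' q) = (\<Sum>g<6. x g * G g p' p q)"
  by (rule sum.cong) (use sym assms in auto)

text \<open>If all contractions restrict to zero, the entries live at \<open>j = j'\<close> and
  agree for both values of \<open>j\<close>. Exchanging the first two arguments carries one of two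
  equal entries to a position with \<open>j \<noteq> j'\<close>, so all vanish.\<close>

lemma comb_res_inj:
  assumes "\<And>p i m k. \<lbrakk>p \<in> mat_idx 2; i < 2; m < 3; k < 2\<rbrakk>
      \<Longrightarrow> (\<Sum>s<2. (\<Sum>g<6. x g * h g s p) * f s i m k) = 0"
  shows "\<forall>g<6. x g = 0"
proof (rule indep)
  define K where "K p p' q = (\<Sum>g<6. x g * G g p p' q)" for p p' q
  have z: "diag_restriction (K p) i m k = 0" if "p \<in> mat_idx 2" "i < 2" "m < 3" "k < 2" for p i m k
    using comb_res[OF that, of x] assms[OF that] by (simp add: K_def [abs_def])
  have s: "K p p' q = K p' p q" if "p \<in> mat_idx 2" "p' \<in> mat_idx 2" "q \<in> mat_idx 2" for p p' q
    unfolding K_def using comb_sym[OF that] .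
  have off: "K p (i, j) (j', k) = 0" if "p \<in> mat_idx 2" "i < 2" "j < 2" "j' < 2" "k < 2" "j \<noteq> j'"
    for p i j j' k
    using z[OF that(1,2) _ that(5), of 0] z[OF that(1,2) _ that(5), of 2] that
    by (auto simp: diag_restriction_def less_2_cases_iff)
  have dg: "K p (i, 1) (1, k) = K p (i, 0) (0, k)" if "p \<in> mat_idx 2" "i < 2" "k < 2" for p i k
    using z[OF that(1,2) _ that(3), of 1] by (simp add: diag_restriction_def)
  have on: "K (i', 0) (i, 0) (0, k) = 0" "K (i', 1) (i, 1) (1, k) = 0" if "i' < 2" "i < 2" "k < 2" for i' i k
  proof -
    have "K (i', 0) (i, 1) (1, k) = K (i, 1) (i', 0) (1, k)"
      by (rule s) (use that in \<open>auto simp: mat_idx_def\<close>)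
    also have "\<dots> = 0" by (rule off) (use that in \<open>auto simp: mat_idx_def\<close>)
    finally show "K (i', 0) (i, 0) (0, k) = 0" using dg[of "(i', 0)" i k] that by (auto simp: mat_idx_def)
    have "K (i', 1) (i, 0) (0, k) = K (i, 0) (i', 1) (0, k)"
      by (rule s) (use that in \<open>auto simp: mat_idx_def\<close>)
    also have "\<dots> = 0" by (rule off) (use that in \<open>auto simp: mat_idx_def\<close>)
    finally show "K (i', 1) (i, 1) (1, k) = 0" using dg[of "(i', 1)" i k] that by (auto simp: mat_idx_def)
  qed
  fix p p' q :: idx assume m: "p \<in> mat_idx 2" "p' \<in> mat_idx 2" "q \<in> mat_idx 2"
  obtain i' j1 where p: "p = (i', j1)" "i' < 2" "j1 < 2" using m(1) by (auto simp: mat_idx_def)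
  obtain i j where p': "p' = (i, j)" "i < 2" "j < 2" using m(2) by (auto simp: mat_idx_def)
  obtain j' k where q: "q = (j', k)" "j' < 2" "k < 2" using m(3) by (auto simp: mat_idx_def)
  have "K p p' q = 0"
  proof (cases "j = j'")
    case False
    then show ?thesis using off[OF m(1)] p' q by auto
  next
    case True
    show ?thesis
    proof (cases "j1 = j'")
      case False
      then show ?thesis using off[OF m(2)] p q s[OF m] by auto
    next
      case True
      then show ?thesis using \<open>j = j'\<close> on[of i' i k] p p' q by (auto simp: less_2_cases_iff)
    qed
  qed
  then show "(\<Sum>g<6. x g * G g p p' q) = 0" by (simp add: K_def)
qed

text \<open>Setting \<open>v\<^sub>1 = v\<^sub>2 = v'\<close> in the form \<open>G(u\<^sub>1, v\<^sub>1; u\<^sub>2, v\<^sub>2; v', w)\<close> leaves a form that is symmetric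
  in \<open>u\<^sub>1, u\<^sub>2\<close>; these are the coefficients of \<open>v\<^sup>0, \<dots>, v\<^sup>3\<close> of its vanishing antisymmetric part.\<close>
lemma comb_equations:
  fixes x :: "nat \<Rightarrow> complex"
  assumes c_def: "\<And>s p. c s p = (\<Sum>g<6. x g * h g s p)" and k: "k < 2"
  shows "(\<Sum>s<2. c s (0, 0) * f s 1 0 k) = (\<Sum>s<2. c s (1, 0) * f s 0 0 k)"
    "(\<Sum>s<2. c s (0, 0) * f s 1 1 k) + (\<Sum>s<2. c s (0, 1) * f s 1 0 k)
      = (\<Sum>s<2. c s (1, 0) * f s 0 1 k) + (\<Sum>s<2. c s (1, 1) * f s 0 0 k)"
    "(\<Sum>s<2. c s (0, 0) * f s 1 2 k) + (\<Sum>s<2. c s (0, 1) * f s 1 1 k)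
      = (\<Sum>s<2. c s (1, 0) * f s 0 2 k) + (\<Sum>s<2. c s (1, 1) * f s 0 1 k)"
    "(\<Sum>s<2. c s (0, 1) * f s 1 2 k) = (\<Sum>s<2. c s (1, 1) * f s 0 2 k)"
proof -
  define K where "K p p' q = (\<Sum>g<6. x g * G g p p' q)" for p p' q
  have d: "(\<Sum>s<2. c s (i', j) * f s i m k) = diag_restriction (K (i', j)) i m k"
    if "i' < 2" "j < 2" "i < 2" "m < 3" for i' j i m
    using comb_res[of "(i', j)" i m k x] that k by (simp add: K_def [abs_def] c_def mat_idx_def)
  have s: "K (0, j) (1, j') (j'', k) = K (1, j') (0, j) (j'', k)" if "j < 2" "j' < 2" "j'' < 2" for j j' j''
    unfolding K_def by (rule comb_sym) (use that k in \<open>auto simp: mat_idx_def\<close>)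
  have s': "K (0, 0) (1, 0) (0, k) = K (1, 0) (0, 0) (0, k)" "K (0, 0) (1, 1) (0, k) = K (1, 1) (0, 0) (0, k)"
    "K (0, 1) (1, 0) (0, k) = K (1, 0) (0, 1) (0, k)" "K (0, 1) (1, 1) (0, k) = K (1, 1) (0, 1) (0, k)"
    "K (0, 0) (1, 0) (1, k) = K (1, 0) (0, 0) (1, k)" "K (0, 0) (1, 1) (1, k) = K (1, 1) (0, 0) (1, k)"
    "K (0, 1) (1, 0) (1, k) = K (1, 0) (0, 1) (1, k)" "K (0, 1) (1, 1) (1, k) = K (1, 1) (0, 1) (1, k)"
    by (rule s; simp)+
  show "(\<Sum>s<2. c s (0, 0) * f s 1 0 k) = (\<Sum>s<2. c s (1, 0) * f s 0 0 k)"
    using s' by (subst (1 2) d) (auto simp: diag_restriction_def)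
  show "(\<Sum>s<2. c s (0, 0) * f s 1 1 k) + (\<Sum>s<2. c s (0, 1) * f s 1 0 k)
      = (\<Sum>s<2. c s (1, 0) * f s 0 1 k) + (\<Sum>s<2. c s (1, 1) * f s 0 0 k)"
    using s' by (subst (1 2 3 4) d) (auto simp: diag_restriction_def)
  show "(\<Sum>s<2. c s (0, 0) * f s 1 2 k) + (\<Sum>s<2. c s (0, 1) * f s 1 1 k)
      = (\<Sum>s<2. c s (1, 0) * f s 0 2 k) + (\<Sum>s<2. c s (1, 1) * f s 0 1 k)"
    using s' by (subst (1 2 3 4) d) (auto simp: diag_restriction_def)
  show "(\<Sum>s<2. c s (0, 1) * f s 1 2 k) = (\<Sum>s<2. c s (1, 1) * f s 0 2 k)"
    using s' by (subst (1 2) d) (auto simp: diag_restriction_def)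
qed

text \<open>If \<open>f 0\<close> and \<open>f 1\<close> were dependent, one number for each of the
  four \<open>p\<close> would govern the restriction of a combination. Four equations in six
  coefficients have a nonzero solution, which contradicts \<open>comb_res_inj\<close>.\<close>

lemma independent_generators:
  assumes "\<And>i m k. \<lbrakk>i < 2; m < 3; k < 2\<rbrakk> \<Longrightarrow> c0 * f 0 i m k + c1 * f 1 i m k = 0"
  shows "c0 = 0 \<and> c1 = 0"
proof (rule ccontr)
  assume ne: "\<not> ?thesis"
  have fin: "finite (mat_idx 2)" "card (mat_idx 2) = 4" by (auto simp: mat_idx_def)
  obtain x where x: "\<exists>g\<in>{..<6::nat}. x g \<noteq> 0"
    "\<forall>p\<in>mat_idx 2. (\<Sum>g<6. (c0 * h g 1 p - c1 * h g 0 p) * x g) = 0"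
    using underdetermined_system_nontrivial[of "mat_idx 2" "{..<6::nat}" "\<lambda>p g. c0 * h g 1 p - c1 * h g 0 p"] fin by auto
  have "\<forall>g<6. x g = 0"
  proof (rule comb_res_inj)
    fix p i m k assume a: "p \<in> mat_idx 2" "i < (2::nat)" "m < (3::nat)" "k < (2::nat)"
    define y where "y s = (\<Sum>g<6. x g * h g s p)" for s
    have "(\<Sum>g<6. (c0 * h g 1 p - c1 * h g 0 p) * x g) = c0 * y 1 - c1 * y 0"
      by (simp add: y_def sum_distrib_left algebra_simps sum_subtractf)
    then have 1: "c0 * y 1 = c1 * y 0" using x(2) a(1) by auto
    have 2: "c0 * f 0 i m k = - (c1 * f 1 i m k)" using assms[OF a(2-4)] by (simp add: add_eq_0_iff)
    have "y 0 * f 0 i m k + y 1 * f 1 i m k = 0"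
    proof (cases "c0 = 0")
      case False
      have "c0 * (y 0 * f 0 i m k + y 1 * f 1 i m k) = y 0 * (c0 * f 0 i m k) + (c0 * y 1) * f 1 i m k"
        by (simp add: algebra_simps)
      also have "\<dots> = 0" unfolding 1 2 by (simp add: algebra_simps)
      finally show ?thesis using False by simp
    next
      case True
      then show ?thesis using ne 1 2 by auto
    qed
    then show "(\<Sum>s<2. (\<Sum>g<6. x g * h g s p) * f s i m k) = 0"
      by (simp add: y_def numeral_2_eq_2)
  qed
  then show False using x(1) by auto
qed

text \<open>The 6-dimensional solution space meets every 3-dimensional coordinate subspace of the
  8-dimensional space of coordinates.\<close>
lemma supported_solution:
  assumes "s < 2" "i < 2" "s' < 2" "i' < 2" "(s, i) \<noteq> (s', i')" "j < 2"
  obtains c x where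
    "c s (i, 0) \<noteq> 0 \<or> c s (i, 1) \<noteq> 0 \<or> c s' (i', j) \<noteq> 0"
    "\<And>s1 i1 j1. \<lbrakk>s1 < 2; i1 < 2; j1 < 2; (s1, i1) \<noteq> (s, i); (s1, i1, j1) \<noteq> (s', i', j)\<rbrakk> \<Longrightarrow> c s1 (i1, j1) = 0"
    "\<And>s p. c s p = (\<Sum>g<6. x g * h g s p)"
proof -
  let ?C = "{..<2::nat} \<times> mat_idx 2" let ?D = "{(s, (i, 0)), (s, (i, 1)), (s', (i', j))}"
  have D: "?D \<subseteq> ?C" "card ?D = 3" using assms by (auto simp: mat_idx_def)
  have "card (?C - ?D) = 5"
    using D by (subst card_Diff_subset) (auto simp: mat_idx_def)
  then obtain x where x: "\<exists>g\<in>{..<6::nat}. x g \<noteq> 0"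
    "\<forall>z\<in>?C - ?D. (\<Sum>g<6. h g (fst z) (snd z) * x g) = 0"
    using underdetermined_system_nontrivial[of "?C - ?D" "{..<6::nat}" "\<lambda>z g. h g (fst z) (snd z)"]
    by (auto simp: mat_idx_def)
  define c where "c = (\<lambda>s p. \<Sum>g<6. x g * h g s p)"
  have off: "c s1 p1 = 0" if "(s1, p1) \<in> ?C - ?D" for s1 p1
    using x(2)[rule_format, OF that] by (simp add: c_def mult.commute)
  have c1: "c s (i, 0) \<noteq> 0 \<or> c s (i, 1) \<noteq> 0 \<or> c s' (i', j) \<noteq> 0"
  proof (rule ccontr)
    assume "\<not> ?thesis"
    then have "c s1 p1 = 0" if "(s1, p1) \<in> ?C" for s1 p1
      using off[of s1 p1] that by (cases "(s1, p1) \<in> ?D") auto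
    then have "\<forall>g<6. x g = 0"
      by (intro comb_res_inj) (simp add: c_def)
    then show False using x(1) by auto
  qed
  have c2: "c s1 (i1, j1) = 0"
    if "s1 < 2" "i1 < 2" "j1 < 2" "(s1, i1) \<noteq> (s, i)" "(s1, i1, j1) \<noteq> (s', i', j)" for s1 i1 j1
    by (rule off) (use that in \<open>auto simp: mat_idx_def\<close>)
  show ?thesis by (rule that[OF c1 c2]) (simp_all add: c_def)
qed

text \<open>A solution supported on \<open>c s (i, 0)\<close>, \<open>c s (i, 1)\<close> and
  \<open>c s' (i', j)\<close> turns \<open>comb_equations\<close> into a relation between
  \<open>v0 p\<close>, \<open>v1 p\<close> and either \<open>v0 q\<close> (for \<open>j = 0\<close>)
  or \<open>v1 q\<close> (for \<open>j = 1\<close>). The antisymmetrisation pairs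
  \<open>c s (i, _)\<close> with the slice at the other index, hence \<open>1 - i\<close>.\<close>

lemma slices_proportional:
  assumes si: "s < 2" "i < 2" "s' < 2" "i' < 2" "(s, i) \<noteq> (s', i')"
    and ne: "m0 < 3" "k0 < 2" "f s (1 - i) m0 k0 \<noteq> 0"
  shows "\<exists>c. \<forall>m<3. \<forall>k<2. f s' (1 - i') m k = c * f s (1 - i) m k"
proof -
  have one_less_two: "(1::nat) < 2" by simp
  let ?p = "f s (1 - i)" and ?q = "f s' (1 - i')"
  \<comment> \<open>The sign with which the terms of \<open>c s (i, _)\<close> enter the
    antisymmetric part.\<close>
  define \<sigma> :: "nat \<Rightarrow> complex" where "\<sigma> i = (if i = 0 then 1 else - 1)" for i
  have "\<exists>\<alpha> \<beta> \<gamma>. (\<alpha> \<noteq> 0 \<or> \<beta> \<noteq> 0 \<or> \<gamma> \<noteq> 0) \<and>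
      (\<forall>k<2. \<alpha> * ?p 0 k + \<gamma> * ?q 0 k = 0 \<and> \<alpha> * ?p 1 k + \<beta> * ?p 0 k + \<gamma> * ?q 1 k = 0 \<and>
        \<alpha> * ?p 2 k + \<beta> * ?p 1 k + \<gamma> * ?q 2 k = 0 \<and> \<beta> * ?p 2 k = 0)"
  proof -
    obtain c x where c: "c s (i, 0) \<noteq> 0 \<or> c s (i, 1) \<noteq> 0 \<or> c s' (i', 0) \<noteq> 0"
      "\<And>s1 i1 j1. \<lbrakk>s1 < 2; i1 < 2; j1 < 2; (s1, i1) \<noteq> (s, i); (s1, i1, j1) \<noteq> (s', i', 0)\<rbrakk> \<Longrightarrow> c s1 (i1, j1) = 0"
      "\<And>s p. c s p = (\<Sum>g<6. x g * h g s p)"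
      using supported_solution[OF si zero_less_numeral] by blast
    note z = c(2)[of 0 0 0] c(2)[of 0 0 1] c(2)[of 0 1 0] c(2)[of 0 1 1]
      c(2)[of 1 0 0] c(2)[of 1 0 1] c(2)[of 1 1 0] c(2)[of 1 1 1]
    have "\<sigma> i * c s (i, 0) * ?p 0 k + \<sigma> i' * c s' (i', 0) * ?q 0 k = 0 \<and>
        \<sigma> i * c s (i, 0) * ?p 1 k + \<sigma> i * c s (i, 1) * ?p 0 k + \<sigma> i' * c s' (i', 0) * ?q 1 k = 0 \<and>
        \<sigma> i * c s (i, 0) * ?p 2 k + \<sigma> i * c s (i, 1) * ?p 1 k + \<sigma> i' * c s' (i', 0) * ?q 2 k = 0 \<and>
        \<sigma> i * c s (i, 1) * ?p 2 k = 0" if "k < 2" for k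
    proof -
      note E = comb_equations[OF c(3) that, unfolded sum_lessThan_2]
      have cs: "s = 0 \<or> s = 1" "i = 0 \<or> i = 1" "s' = 0 \<or> s' = 1" "i' = 0 \<or> i' = 1" using si by auto
      have g0: "\<sigma> i * c s (i, 0) * ?p 0 k + \<sigma> i' * c s' (i', 0) * ?q 0 k
          = (c 0 (0, 0) * f 0 1 0 k + c 1 (0, 0) * f 1 1 0 k)
            - (c 0 (1, 0) * f 0 0 0 k + c 1 (1, 0) * f 1 0 0 k)"
        using cs z si(5) by (elim disjE) (simp_all add: \<sigma>_def)
      have g1: "\<sigma> i * c s (i, 0) * ?p 1 k + \<sigma> i * c s (i, 1) * ?p 0 k + \<sigma> i' * c s' (i', 0) * ?q 1 k
          = ((c 0 (0, 0) * f 0 1 1 k + c 1 (0, 0) * f 1 1 1 k) + (c 0 (0, 1) * f 0 1 0 k + c 1 (0, 1) * f 1 1 0 k))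
            - ((c 0 (1, 0) * f 0 0 1 k + c 1 (1, 0) * f 1 0 1 k) + (c 0 (1, 1) * f 0 0 0 k + c 1 (1, 1) * f 1 0 0 k))"
        using cs z si(5) by (elim disjE) (simp_all add: \<sigma>_def)
      have g2: "\<sigma> i * c s (i, 0) * ?p 2 k + \<sigma> i * c s (i, 1) * ?p 1 k + \<sigma> i' * c s' (i', 0) * ?q 2 k
          = ((c 0 (0, 0) * f 0 1 2 k + c 1 (0, 0) * f 1 1 2 k) + (c 0 (0, 1) * f 0 1 1 k + c 1 (0, 1) * f 1 1 1 k))
            - ((c 0 (1, 0) * f 0 0 2 k + c 1 (1, 0) * f 1 0 2 k) + (c 0 (1, 1) * f 0 0 1 k + c 1 (1, 1) * f 1 0 1 k))"
        using cs z si(5) by (elim disjE) (simp_all add: \<sigma>_def)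
      have g3: "\<sigma> i * c s (i, 1) * ?p 2 k
          = (c 0 (0, 1) * f 0 1 2 k + c 1 (0, 1) * f 1 1 2 k)
            - (c 0 (1, 1) * f 0 0 2 k + c 1 (1, 1) * f 1 0 2 k)"
        using cs z si(5) by (elim disjE) (simp_all add: \<sigma>_def)
      show ?thesis unfolding g0 g1 g2 g3 E by simp
    qed
    moreover have "\<sigma> i * c s (i, 0) \<noteq> 0 \<or> \<sigma> i * c s (i, 1) \<noteq> 0 \<or> \<sigma> i' * c s' (i', 0) \<noteq> 0"
      using c(1) by (auto simp: \<sigma>_def)
    ultimately show ?thesis by blast
  qed
  moreover have "\<exists>\<alpha> \<beta> \<gamma>. (\<alpha> \<noteq> 0 \<or> \<beta> \<noteq> 0 \<or> \<gamma> \<noteq> 0) \<and>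
      (\<forall>k<2. \<alpha> * ?p 0 k = 0 \<and> \<alpha> * ?p 1 k + \<beta> * ?p 0 k + \<gamma> * ?q 0 k = 0 \<and>
        \<alpha> * ?p 2 k + \<beta> * ?p 1 k + \<gamma> * ?q 1 k = 0 \<and> \<beta> * ?p 2 k + \<gamma> * ?q 2 k = 0)"
  proof -
    obtain c x where c: "c s (i, 0) \<noteq> 0 \<or> c s (i, 1) \<noteq> 0 \<or> c s' (i', 1) \<noteq> 0"
      "\<And>s1 i1 j1. \<lbrakk>s1 < 2; i1 < 2; j1 < 2; (s1, i1) \<noteq> (s, i); (s1, i1, j1) \<noteq> (s', i', 1)\<rbrakk> \<Longrightarrow> c s1 (i1, j1) = 0"
      "\<And>s p. c s p = (\<Sum>g<6. x g * h g s p)"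
      using supported_solution[OF si one_less_two] by blast
    note z = c(2)[of 0 0 0] c(2)[of 0 0 1] c(2)[of 0 1 0] c(2)[of 0 1 1]
      c(2)[of 1 0 0] c(2)[of 1 0 1] c(2)[of 1 1 0] c(2)[of 1 1 1]
    have "\<sigma> i * c s (i, 0) * ?p 0 k = 0 \<and>
        \<sigma> i * c s (i, 0) * ?p 1 k + \<sigma> i * c s (i, 1) * ?p 0 k + \<sigma> i' * c s' (i', 1) * ?q 0 k = 0 \<and>
        \<sigma> i * c s (i, 0) * ?p 2 k + \<sigma> i * c s (i, 1) * ?p 1 k + \<sigma> i' * c s' (i', 1) * ?q 1 k = 0 \<and>
        \<sigma> i * c s (i, 1) * ?p 2 k + \<sigma> i' * c s' (i', 1) * ?q 2 k = 0" if "k < 2" for k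
    proof -
      note E = comb_equations[OF c(3) that, unfolded sum_lessThan_2]
      have cs: "s = 0 \<or> s = 1" "i = 0 \<or> i = 1" "s' = 0 \<or> s' = 1" "i' = 0 \<or> i' = 1" using si by auto
      have g0: "\<sigma> i * c s (i, 0) * ?p 0 k
          = (c 0 (0, 0) * f 0 1 0 k + c 1 (0, 0) * f 1 1 0 k)
            - (c 0 (1, 0) * f 0 0 0 k + c 1 (1, 0) * f 1 0 0 k)"
        using cs z si(5) by (elim disjE) (simp_all add: \<sigma>_def)
      have g1: "\<sigma> i * c s (i, 0) * ?p 1 k + \<sigma> i * c s (i, 1) * ?p 0 k + \<sigma> i' * c s' (i', 1) * ?q 0 k
          = ((c 0 (0, 0) * f 0 1 1 k + c 1 (0, 0) * f 1 1 1 k) + (c 0 (0, 1) * f 0 1 0 k + c 1 (0, 1) * f 1 1 0 k))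
            - ((c 0 (1, 0) * f 0 0 1 k + c 1 (1, 0) * f 1 0 1 k) + (c 0 (1, 1) * f 0 0 0 k + c 1 (1, 1) * f 1 0 0 k))"
        using cs z si(5) by (elim disjE) (simp_all add: \<sigma>_def)
      have g2: "\<sigma> i * c s (i, 0) * ?p 2 k + \<sigma> i * c s (i, 1) * ?p 1 k + \<sigma> i' * c s' (i', 1) * ?q 1 k
          = ((c 0 (0, 0) * f 0 1 2 k + c 1 (0, 0) * f 1 1 2 k) + (c 0 (0, 1) * f 0 1 1 k + c 1 (0, 1) * f 1 1 1 k))
            - ((c 0 (1, 0) * f 0 0 2 k + c 1 (1, 0) * f 1 0 2 k) + (c 0 (1, 1) * f 0 0 1 k + c 1 (1, 1) * f 1 0 1 k))"
        using cs z si(5) by (elim disjE) (simp_all add: \<sigma>_def)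
      have g3: "\<sigma> i * c s (i, 1) * ?p 2 k + \<sigma> i' * c s' (i', 1) * ?q 2 k
          = (c 0 (0, 1) * f 0 1 2 k + c 1 (0, 1) * f 1 1 2 k)
            - (c 0 (1, 1) * f 0 0 2 k + c 1 (1, 1) * f 1 0 2 k)"
        using cs z si(5) by (elim disjE) (simp_all add: \<sigma>_def)
      show ?thesis unfolding g0 g1 g2 g3 E by simp
    qed
    moreover have "\<sigma> i * c s (i, 0) \<noteq> 0 \<or> \<sigma> i * c s (i, 1) \<noteq> 0 \<or> \<sigma> i' * c s' (i', 1) \<noteq> 0"
      using c(1) by (auto simp: \<sigma>_def)
    ultimately show ?thesis by blast
  qed
  ultimately show ?thesis by (rule proportional_if_shifts_dependent[where p = ?p, OF ne])
qed

text \<open>This is the factorisation \<open>Q = U * P(v, w)\<close>: any nonzero slice serves as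
  \<open>P\<close>, and every other slice is a multiple of it.\<close>

lemma generators_factor:
  "\<exists>P \<mu>. \<forall>s<2. \<forall>i<2. \<forall>m<3. \<forall>k<2. f s i m k = \<mu> s i * P m k"
proof (cases "\<exists>s i m k. s < 2 \<and> i < 2 \<and> m < 3 \<and> k < 2 \<and> f s i m k \<noteq> 0")
  case True
  then obtain s i m0 k0 where si: "s < 2" "i < 2" "m0 < 3" "k0 < 2" "f s i m0 k0 \<noteq> 0" by blast
  have "\<exists>c. \<forall>m<3. \<forall>k<2. f s' i' m k = c * f s i m k" if "s' < 2" "i' < 2" for s' i'
  proof (cases "(s', i') = (s, i)")
    case True
    then show ?thesis by (intro exI[of _ 1]) auto
  next
    case False
    have inv: "1 - (1 - i) = i" "1 - (1 - i') = i'" using si that by auto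
    have "(s, 1 - i) \<noteq> (s', 1 - i')" using False inv by (metis prod.inject)
    then show ?thesis
      using slices_proportional[of s "1 - i" s' "1 - i'" m0 k0] si that by (auto simp: inv)
  qed
  then have "\<exists>\<mu>. \<forall>s' i'. s' < 2 \<longrightarrow> i' < 2 \<longrightarrow> (\<forall>m<3. \<forall>k<2. f s' i' m k = \<mu> s' i' * f s i m k)"
    by metis
  then show ?thesis by blast
next
  case False
  then show ?thesis by (intro exI[of _ "\<lambda>_ _. 0"]) auto
qed

end

section \<open>Limits of the spans of the products\<close>

definition span_limit :: "nat \<Rightarrow> (nat \<Rightarrow> nat \<Rightarrow> idx \<Rightarrow> complex) \<Rightarrow> (nat \<Rightarrow> nat \<Rightarrow> idx \<Rightarrow> complex)
    \<Rightarrow> (idx \<Rightarrow> idx \<Rightarrow> complex) \<Rightarrow> bool" where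
  "span_limit r a b e \<longleftrightarrow> (\<exists>\<xi>. \<forall>p\<in>mat_idx 2. \<forall>q\<in>mat_idx 2.
     (\<lambda>t. \<Sum>l<r. \<xi> t l * (a t l p * b t l q)) \<longlonglongrightarrow> e p q)"

text \<open>The four slices of the matrix multiplication tensor and three further limits are seven
  limits from spans of six products, hence dependent. The restriction kills the slices, and these
  are independent, so the relation involves the other three. Thus \<open>Q\<close> has dimension at
  most two.\<close>

lemma span_limit_restrictions_dependent:
  fixes a b :: "nat \<Rightarrow> nat \<Rightarrow> idx \<Rightarrow> complex"
  assumes M: "\<forall>s\<in>mat_idx 2. span_limit 6 a b (\<lambda>p q. matmult_tensor 2 p q s)"
    and e: "span_limit 6 a b e0" "span_limit 6 a b e1" "span_limit 6 a b e2"
  shows "\<exists>c0 c1 c2. (c0 \<noteq> 0 \<or> c1 \<noteq> 0 \<or> c2 \<noteq> 0) \<and>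
    (\<forall>i<2. \<forall>m<3. \<forall>k<2. c0 * diag_restriction e0 i m k + c1 * diag_restriction e1 i m k
       + c2 * diag_restriction e2 i m k = 0)"
proof -
  define es :: "nat \<Rightarrow> idx \<Rightarrow> idx \<Rightarrow> complex" where
    "es g = [\<lambda>p q. matmult_tensor 2 p q (0, 0), \<lambda>p q. matmult_tensor 2 p q (0, 1),
       \<lambda>p q. matmult_tensor 2 p q (1, 0), \<lambda>p q. matmult_tensor 2 p q (1, 1), e0, e1, e2] ! g" for g
  have seven: "(g::nat) < 7 \<Longrightarrow> g = 0 \<or> g = 1 \<or> g = 2 \<or> g = 3 \<or> g = 4 \<or> g = 5 \<or> g = 6" for g
    by linarith
  have "span_limit 6 a b (es g)" if "g < 7" for g
    using M e seven[OF that] by (auto simp: es_def mat_idx_def)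
  then have ex: "\<forall>g. \<exists>\<xi>. g < 7 \<longrightarrow> (\<forall>p\<in>mat_idx 2. \<forall>q\<in>mat_idx 2.
      (\<lambda>t. \<Sum>l<6. \<xi> t l * (a t l p * b t l q)) \<longlonglongrightarrow> es g p q)"
    unfolding span_limit_def by blast
  from choice[OF ex] obtain \<xi> where \<xi>: "\<forall>g. g < 7 \<longrightarrow> (\<forall>p\<in>mat_idx 2. \<forall>q\<in>mat_idx 2.
      (\<lambda>t. \<Sum>l<6. \<xi> g t l * (a t l p * b t l q)) \<longlonglongrightarrow> es g p q)"
    by (elim exE)
  have "\<exists>x. (\<exists>g<7. x g \<noteq> 0) \<and> (\<forall>z\<in>mat_idx 2 \<times> mat_idx 2. (\<Sum>g<7. x g * es g (fst z) (snd z)) = 0)"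
    by (rule limits_of_span_dependent[where \<xi> = \<xi> and d = 6 and v = "\<lambda>t l z. a t l (fst z) * b t l (snd z)"])
      (use \<xi> in auto)
  then obtain x where x: "\<exists>g<7. x g \<noteq> 0"
    "\<And>p q. \<lbrakk>p \<in> mat_idx 2; q \<in> mat_idx 2\<rbrakk> \<Longrightarrow> (\<Sum>g<7. x g * es g p q) = 0"
    by auto
  have s7: "(\<Sum>g<7::nat. F g) = F 0 + F 1 + F 2 + F 3 + F 4 + F 5 + F 6" for F :: "nat \<Rightarrow> complex"
    by (simp add: eval_nat_numeral)
  have x': "x 0 * matmult_tensor 2 p q (0, 0) + x 1 * matmult_tensor 2 p q (0, 1)
      + x 2 * matmult_tensor 2 p q (1, 0) + x 3 * matmult_tensor 2 p q (1, 1)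
      + x 4 * e0 p q + x 5 * e1 p q + x 6 * e2 p q = 0"
    if "p \<in> mat_idx 2" "q \<in> mat_idx 2" for p q
    using x(2)[OF that] unfolding s7 by (simp add: es_def)
  have "x 4 * diag_restriction e0 i m k + x 5 * diag_restriction e1 i m k
       + x 6 * diag_restriction e2 i m k = 0" if "i < 2" "m < 3" "k < 2" for i m k
  proof -
    have c: "i = 0 \<or> i = 1" "m = 0 \<or> m = 1 \<or> m = 2" "k = 0 \<or> k = 1" using that by auto
    have eqs: "x 4 * e0 (i, 0) (1, k) + x 5 * e1 (i, 0) (1, k) + x 6 * e2 (i, 0) (1, k) = 0"
      "x 4 * e0 (i, 1) (0, k) + x 5 * e1 (i, 1) (0, k) + x 6 * e2 (i, 1) (0, k) = 0"
      "x 4 * e0 (i, 0) (0, k) + x 5 * e1 (i, 0) (0, k) + x 6 * e2 (i, 0) (0, k)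
       = x 4 * e0 (i, 1) (1, k) + x 5 * e1 (i, 1) (1, k) + x 6 * e2 (i, 1) (1, k)"
    proof -
      show "x 4 * e0 (i, 0) (1, k) + x 5 * e1 (i, 0) (1, k) + x 6 * e2 (i, 0) (1, k) = 0"
        using x'[of "(i, 0)" "(1, k)"] that by (simp add: matmult_tensor_def mat_idx_def)
      show "x 4 * e0 (i, 1) (0, k) + x 5 * e1 (i, 1) (0, k) + x 6 * e2 (i, 1) (0, k) = 0"
        using x'[of "(i, 1)" "(0, k)"] that by (simp add: matmult_tensor_def mat_idx_def)
      define y where "y = x 0 * matmult_tensor 2 (i, 0) (0, k) (0, 0) + x 1 * matmult_tensor 2 (i, 0) (0, k) (0, 1)
        + x 2 * matmult_tensor 2 (i, 0) (0, k) (1, 0) + x 3 * matmult_tensor 2 (i, 0) (0, k) (1, 1)"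
      have y': "y = x 0 * matmult_tensor 2 (i, 1) (1, k) (0, 0) + x 1 * matmult_tensor 2 (i, 1) (1, k) (0, 1)
        + x 2 * matmult_tensor 2 (i, 1) (1, k) (1, 0) + x 3 * matmult_tensor 2 (i, 1) (1, k) (1, 1)"
        by (simp add: y_def matmult_tensor_def)
      have "y + (x 4 * e0 (i, 0) (0, k) + x 5 * e1 (i, 0) (0, k) + x 6 * e2 (i, 0) (0, k)) = 0"
        using x'[of "(i, 0)" "(0, k)"] that unfolding y_def by (simp add: mat_idx_def add.assoc)
      moreover have "y + (x 4 * e0 (i, 1) (1, k) + x 5 * e1 (i, 1) (1, k) + x 6 * e2 (i, 1) (1, k)) = 0"
        using x'[of "(i, 1)" "(1, k)"] that unfolding y' by (simp add: mat_idx_def add.assoc)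
      ultimately show "x 4 * e0 (i, 0) (0, k) + x 5 * e1 (i, 0) (0, k) + x 6 * e2 (i, 0) (0, k)
        = x 4 * e0 (i, 1) (1, k) + x 5 * e1 (i, 1) (1, k) + x 6 * e2 (i, 1) (1, k)"
        by (metis add_left_cancel)
    qed
    consider "m = 0" | "m = 1" | "m = 2" using c by blast
    then show ?thesis
    proof cases
      case 1
      then show ?thesis using eqs(1) by (simp add: diag_restriction_def)
    next
      case 2
      then have "x 4 * diag_restriction e0 i m k + x 5 * diag_restriction e1 i m k + x 6 * diag_restriction e2 i m k
        = (x 4 * e0 (i, 1) (1, k) + x 5 * e1 (i, 1) (1, k) + x 6 * e2 (i, 1) (1, k))
          - (x 4 * e0 (i, 0) (0, k) + x 5 * e1 (i, 0) (0, k) + x 6 * e2 (i, 0) (0, k))"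
        by (simp add: diag_restriction_def algebra_simps)
      then show ?thesis using eqs(3) by simp
    next
      case 3
      then have "x 4 * diag_restriction e0 i m k + x 5 * diag_restriction e1 i m k + x 6 * diag_restriction e2 i m k
        = - (x 4 * e0 (i, 1) (0, k) + x 5 * e1 (i, 1) (0, k) + x 6 * e2 (i, 1) (0, k))"
        by (simp add: diag_restriction_def algebra_simps)
      then show ?thesis by (simp only: eqs(2) minus_zero)
    qed
  qed
  moreover have "x 4 \<noteq> 0 \<or> x 5 \<noteq> 0 \<or> x 6 \<noteq> 0"
  proof (rule ccontr)
    assume z: "\<not> ?thesis"
    have "x 0 = 0" using x'[of "(0, 0)" "(0, 0)"] z by (simp add: matmult_tensor_def mat_idx_def)
    moreover have "x 1 = 0" using x'[of "(1, 0)" "(0, 0)"] z by (simp add: matmult_tensor_def mat_idx_def)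
    moreover have "x 2 = 0" using x'[of "(0, 0)" "(0, 1)"] z by (simp add: matmult_tensor_def mat_idx_def)
    moreover have "x 3 = 0" using x'[of "(1, 0)" "(0, 1)"] z by (simp add: matmult_tensor_def mat_idx_def)
    ultimately show False using x(1) z by (auto dest!: seven)
  qed
  ultimately show ?thesis by blast
qed

lemma span_limit_generators:
  assumes M: "\<forall>s\<in>mat_idx 2. span_limit 6 a b (\<lambda>p q. matmult_tensor 2 p q s)"
  shows "\<exists>f :: nat \<Rightarrow> nat \<Rightarrow> nat \<Rightarrow> nat \<Rightarrow> complex. \<forall>e. span_limit 6 a b e \<longrightarrow>
    (\<exists>h. \<forall>i<2. \<forall>m<3. \<forall>k<2. diag_restriction e i m k = (\<Sum>s<2. h s * f s i m k))"
proof -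
  define X where "X = {..<2::nat} \<times> {..<3::nat} \<times> {..<2::nat}"
  define R where "R e = (\<lambda>(i, m, k). diag_restriction e i m k)" for e
  have "\<exists>f0 f1. \<forall>z\<in>R ` {e. span_limit 6 a b e}. \<exists>c0 c1. \<forall>i\<in>X. z i = c0 * f0 i + c1 * f1 i"
  proof (rule two_generators)
    fix z0 z1 z2 assume "z0 \<in> R ` {e. span_limit 6 a b e}" "z1 \<in> R ` {e. span_limit 6 a b e}"
      "z2 \<in> R ` {e. span_limit 6 a b e}"
    then obtain e0 e1 e2 where e: "span_limit 6 a b e0" "span_limit 6 a b e1" "span_limit 6 a b e2"
      "z0 = R e0" "z1 = R e1" "z2 = R e2" by blast
    obtain c0 c1 c2 where c: "c0 \<noteq> 0 \<or> c1 \<noteq> 0 \<or> c2 \<noteq> 0"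
      "\<forall>i<2. \<forall>m<3. \<forall>k<2. c0 * diag_restriction e0 i m k + c1 * diag_restriction e1 i m k
         + c2 * diag_restriction e2 i m k = 0"
      using span_limit_restrictions_dependent[OF M e(1-3)] by blast
    have "\<forall>i\<in>X. c0 * z0 i + c1 * z1 i + c2 * z2 i = 0"
      using c(2) by (auto simp: X_def R_def e)
    then show "\<exists>c0 c1 c2. (c0 \<noteq> 0 \<or> c1 \<noteq> 0 \<or> c2 \<noteq> 0) \<and>
        (\<forall>i\<in>X. c0 * z0 i + c1 * z1 i + c2 * z2 i = 0)"
      using c(1) by blast
  qed
  then obtain f0 f1 where f: "\<And>e. span_limit 6 a b e \<Longrightarrow> \<exists>c0 c1. \<forall>i\<in>X. R e i = c0 * f0 i + c1 * f1 i"
    by blast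
  show ?thesis
  proof (intro exI[of _ "\<lambda>s i m k. if s = 0 then f0 (i, m, k) else f1 (i, m, k)"] allI impI)
    fix e assume "span_limit 6 a b e"
    then obtain c0 c1 where c: "\<forall>i\<in>X. R e i = c0 * f0 i + c1 * f1 i" using f by blast
    show "\<exists>h. \<forall>i<2. \<forall>m<3. \<forall>k<2. diag_restriction e i m k
        = (\<Sum>s<2. h s * (if s = (0::nat) then f0 (i, m, k) else f1 (i, m, k)))"
    proof (intro exI allI impI)
      fix i m k :: nat assume "i < 2" "m < 3" "k < 2"
      then have "R e (i, m, k) = c0 * f0 (i, m, k) + c1 * f1 (i, m, k)" using c by (simp add: X_def)
      then show "diag_restriction e i m k
        = (\<Sum>s<2. (if s = 0 then c0 else c1) * (if s = (0::nat) then f0 (i, m, k) else f1 (i, m, k)))"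
        by (simp add: R_def sum_lessThan_2)
    qed
  qed
qed

lemma matmult_2_not_approximable_6: "\<not> approximable 2 (matmult_tensor 2) 6"
proof
  let ?J = "mat_idx 2" and ?I = "mat_idx 2 \<times> mat_idx 2 \<times> mat_idx 2"
  assume ap: "approximable 2 (matmult_tensor 2) 6"
  have fin: "finite ?I" by simp
  have "6 \<le> card ?J * card ?J" by (simp add: mat_idx_def)
  then have ex: "\<forall>t. \<exists>abc. (\<forall>p\<in>?J. \<forall>q\<in>?J. \<forall>s\<in>?J.
      norm (sum_rank_one 6 (fst abc) (fst (snd abc)) (snd (snd abc)) p q s - matmult_tensor 2 p q s)
        < inverse (real (Suc t))) \<and> independent_products ?J 6 (fst abc) (fst (snd abc))"
    using approximable_independent[OF ap, of "inverse (real (Suc _))"] by (auto simp: split_paired_Ex)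
  from choice[OF ex] obtain abc where abc: "\<forall>t. (\<forall>p\<in>?J. \<forall>q\<in>?J. \<forall>s\<in>?J.
      norm (sum_rank_one 6 (fst (abc t)) (fst (snd (abc t))) (snd (snd (abc t))) p q s - matmult_tensor 2 p q s)
        < inverse (real (Suc t))) \<and> independent_products ?J 6 (fst (abc t)) (fst (snd (abc t)))"
    by (elim exE)
  define a where "a t = fst (abc t)" for t
  define b where "b t = fst (snd (abc t))" for t
  define c where "c t = snd (snd (abc t))" for t
  have lim: "(\<lambda>t. sum_rank_one 6 (a t) (b t) (c t) p q s) \<longlonglongrightarrow> matmult_tensor 2 p q s"
    if "p \<in> ?J" "q \<in> ?J" "s \<in> ?J" for p q s
    by (rule tendsto_if_inverse_Suc_bound) (use abc that in \<open>simp add: a_def b_def c_def\<close>)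
  have ind: "independent_products ?J 6 (a t) (b t)" for t
    using abc by (simp add: a_def b_def)

  define vA where "vA t l z = a t l (fst z) * a t l (fst (snd z)) * b t l (snd (snd z))"
    for t l and z :: "idx \<times> idx \<times> idx"
  have "\<forall>t x. (\<forall>z\<in>?I. (\<Sum>l<6. x l * vA t l z) = 0) \<longrightarrow> (\<forall>l<6. x l = 0)"
  proof (intro allI impI)
    fix t x and l :: nat assume z: "\<forall>z\<in>?I. (\<Sum>l<6. x l * vA t l z) = 0" and l: "l < 6"
    have "\<forall>l<6. x l = 0"
      by (rule independent_squares[OF ind[of t]]) (use z in \<open>simp add: vA_def\<close>)
    then show "x l = 0" using l by simp
  qed
  from limit_of_independent_families[OF fin this] obtain \<phi> \<kappa>A and wA :: "nat \<Rightarrow> idx \<times> idx \<times> idx \<Rightarrow> complex" where WA: "strict_mono \<phi> \<and>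
    (\<forall>g<6. \<forall>z\<in>?I. (\<lambda>t. \<Sum>l<6. \<kappa>A t g l * vA (\<phi> t) l z) \<longlonglongrightarrow> wA g z) \<and>
    (\<forall>x. (\<forall>z\<in>?I. (\<Sum>g<6. x g * wA g z) = 0) \<longrightarrow> (\<forall>g<6. x g = 0))"
    by (elim exE)
  note \<phi> = WA[THEN conjunct1]
    and wA = WA[THEN conjunct2, THEN conjunct1, rule_format]
    and indA = WA[THEN conjunct2, THEN conjunct2, THEN spec, THEN mp]
  \<comment> \<open>This family is taken along \<open>\<phi>\<close>, so that \<open>\<phi>\<close>
    followed by \<open>\<psi>\<close> is one subsequence serving both prolongations of the same
    space \<open>E\<close>.\<close>
  define vB where "vB t l z = b (\<phi> t) l (fst z) * b (\<phi> t) l (fst (snd z)) * a (\<phi> t) l (snd (snd z))"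
    for t l and z :: "idx \<times> idx \<times> idx"
  have "\<forall>t x. (\<forall>z\<in>?I. (\<Sum>l<6. x l * vB t l z) = 0) \<longrightarrow> (\<forall>l<6. x l = 0)"
  proof (intro allI impI)
    fix t x and l :: nat assume z: "\<forall>z\<in>?I. (\<Sum>l<6. x l * vB t l z) = 0" and l: "l < 6"
    have "\<forall>l<6. x l = 0"
      by (rule independent_squares[OF independent_products_commute[OF ind[of "\<phi> t"]]]) (use z in \<open>simp add: vB_def\<close>)
    then show "x l = 0" using l by simp
  qed
  from limit_of_independent_families[OF fin this] obtain \<psi> \<kappa>B and wB :: "nat \<Rightarrow> idx \<times> idx \<times> idx \<Rightarrow> complex" where WB: "strict_mono \<psi> \<and>
    (\<forall>g<6. \<forall>z\<in>?I. (\<lambda>t. \<Sum>l<6. \<kappa>B t g l * vB (\<psi> t) l z) \<longlonglongrightarrow> wB g z) \<and>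
    (\<forall>x. (\<forall>z\<in>?I. (\<Sum>g<6. x g * wB g z) = 0) \<longrightarrow> (\<forall>g<6. x g = 0))"
    by (elim exE)
  note \<psi> = WB[THEN conjunct1]
    and wB = WB[THEN conjunct2, THEN conjunct1, rule_format]
    and indB = WB[THEN conjunct2, THEN conjunct2, THEN spec, THEN mp]

  define A where "A t = a (\<phi> (\<psi> t))" for t
  define B where "B t = b (\<phi> (\<psi> t))" for t
  have E_M: "span_limit 6 A B (\<lambda>p q. matmult_tensor 2 p q s)" if "s \<in> ?J" for s
    unfolding span_limit_def
  proof (intro exI ballI)
    fix p q assume pq: "p \<in> ?J" "q \<in> ?J"
    have "strict_mono (\<phi> \<circ> \<psi>)" using \<phi> \<psi> by (simp add: strict_mono_def)
    from LIMSEQ_subseq_LIMSEQ[OF lim[OF pq that] this]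
    show "(\<lambda>t. \<Sum>l<6. c (\<phi> (\<psi> t)) l s * (A t l p * B t l q)) \<longlonglongrightarrow> matmult_tensor 2 p q s"
      by (simp add: o_def sum_rank_one_def A_def B_def mult_ac)
  qed
  \<comment> \<open>Contracting the first factor of a limit of
    \<open>a \<otimes> a \<otimes> b\<close> combinations lands in \<open>E\<close>: the entry
    \<open>A t l p\<close> becomes part of the coefficient.\<close>
  have E_A: "span_limit 6 A B (\<lambda>p' q. wA g (p, p', q))" if "g < 6" "p \<in> ?J" for g p
    unfolding span_limit_def
  proof (intro exI ballI)
    fix p' q assume pq: "p' \<in> ?J" "q \<in> ?J"
    have "(\<lambda>t. \<Sum>l<6. \<kappa>A t g l * vA (\<phi> t) l (p, p', q)) \<longlonglongrightarrow> wA g (p, p', q)"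
      using wA that pq by simp
    from LIMSEQ_subseq_LIMSEQ[OF this \<psi>]
    show "(\<lambda>t. \<Sum>l<6. (\<kappa>A (\<psi> t) g l * A t l p) * (A t l p' * B t l q)) \<longlonglongrightarrow> wA g (p, p', q)"
      by (simp add: o_def vA_def A_def B_def mult_ac)
  qed
  have E_B: "span_limit 6 A B (\<lambda>p q'. wB g (q, q', p))" if "g < 6" "q \<in> ?J" for g q
    unfolding span_limit_def
  proof (intro exI ballI)
    fix p q' assume pq: "p \<in> ?J" "q' \<in> ?J"
    have "(\<lambda>t. \<Sum>l<6. \<kappa>B t g l * vB (\<psi> t) l (q, q', p)) \<longlonglongrightarrow> wB g (q, q', p)"
      using wB that pq by simp
    then show "(\<lambda>t. \<Sum>l<6. (\<kappa>B t g l * B t l q) * (A t l p * B t l q')) \<longlonglongrightarrow> wB g (q, q', p)"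
      by (simp add: vB_def A_def B_def mult_ac)
  qed
  have symA: "wA g (p, p', q) = wA g (p', p, q)" if "g < 6" "p \<in> ?J" "p' \<in> ?J" "q \<in> ?J" for g p p' q
  proof (rule LIMSEQ_unique)
    show "(\<lambda>t. \<Sum>l<6. \<kappa>A t g l * vA (\<phi> t) l (p, p', q)) \<longlonglongrightarrow> wA g (p, p', q)"
      by (rule wA) (use that in auto)
    have "(\<lambda>t. \<Sum>l<6. \<kappa>A t g l * vA (\<phi> t) l (p', p, q)) \<longlonglongrightarrow> wA g (p', p, q)"
      by (rule wA) (use that in auto)
    then show "(\<lambda>t. \<Sum>l<6. \<kappa>A t g l * vA (\<phi> t) l (p, p', q)) \<longlonglongrightarrow> wA g (p', p, q)"
      by (simp add: vA_def mult_ac)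
  qed
  have symB: "wB g (p, p', q) = wB g (p', p, q)" if "g < 6" "p \<in> ?J" "p' \<in> ?J" "q \<in> ?J" for g p p' q
  proof (rule LIMSEQ_unique)
    show "(\<lambda>t. \<Sum>l<6. \<kappa>B t g l * vB (\<psi> t) l (p, p', q)) \<longlonglongrightarrow> wB g (p, p', q)"
      by (rule wB) (use that in auto)
    have "(\<lambda>t. \<Sum>l<6. \<kappa>B t g l * vB (\<psi> t) l (p', p, q)) \<longlonglongrightarrow> wB g (p', p, q)"
      by (rule wB) (use that in auto)
    then show "(\<lambda>t. \<Sum>l<6. \<kappa>B t g l * vB (\<psi> t) l (p, p', q)) \<longlonglongrightarrow> wB g (p', p, q)"
      by (simp add: vB_def mult_ac)
  qed
  have "\<forall>s\<in>?J. span_limit 6 A B (\<lambda>p q. matmult_tensor 2 p q s)"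
    using E_M by blast
  from span_limit_generators[OF this] obtain f :: "nat \<Rightarrow> nat \<Rightarrow> nat \<Rightarrow> nat \<Rightarrow> complex"
    where gen: "\<forall>e. span_limit 6 A B e \<longrightarrow>
      (\<exists>h. \<forall>i<2. \<forall>m<3. \<forall>k<2. diag_restriction e i m k = (\<Sum>s<2. h s * f s i m k))"
    by (elim exE)
  note f = gen[rule_format]

  have exA: "\<forall>gp. \<exists>h. fst gp < 6 \<and> snd gp \<in> ?J \<longrightarrow>
      (\<forall>i<2. \<forall>m<3. \<forall>k<2. diag_restriction (\<lambda>p' q. wA (fst gp) (snd gp, p', q)) i m k = (\<Sum>s<2. h s * f s i m k))"
    using f[OF E_A, rule_format] by simp
  from choice[OF exA] obtain hA where hA0: "\<forall>gp. fst gp < 6 \<and> snd gp \<in> ?J \<longrightarrow>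
      (\<forall>i<2. \<forall>m<3. \<forall>k<2. diag_restriction (\<lambda>p' q. wA (fst gp) (snd gp, p', q)) i m k = (\<Sum>s<2. hA gp s * f s i m k))"
    by (elim exE)
  have hA: "diag_restriction (\<lambda>p' q. wA g (p, p', q)) i m k = (\<Sum>s<2. hA (g, p) s * f s i m k)"
    if "g < 6" "p \<in> ?J" "i < 2" "m < 3" "k < 2" for g p i m k
    using hA0[rule_format, of "(g, p)"] that by simp
  interpret A: limit_prolongation "\<lambda>g p p' q. wA g (p, p', q)" "\<lambda>g s p. hA (g, p) s" f
  proof
    show "\<forall>g<6. x g = 0" if "\<And>p p' q. \<lbrakk>p \<in> ?J; p' \<in> ?J; q \<in> ?J\<rbrakk> \<Longrightarrow> (\<Sum>g<6. x g * wA g (p, p', q)) = 0" for x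
      by (rule indA) (use that in auto)
  qed (use symA hA in auto)

  have exB: "\<forall>gp. \<exists>h. fst gp < 6 \<and> snd gp \<in> ?J \<longrightarrow>
      (\<forall>i<2. \<forall>m<3. \<forall>k<2. diag_restriction (\<lambda>p q'. wB (fst gp) (snd gp, q', p)) i m k = (\<Sum>s<2. h s * f s i m k))"
    using f[OF E_B, rule_format] by simp
  from choice[OF exB] obtain hB where hB0: "\<forall>gp. fst gp < 6 \<and> snd gp \<in> ?J \<longrightarrow>
      (\<forall>i<2. \<forall>m<3. \<forall>k<2. diag_restriction (\<lambda>p q'. wB (fst gp) (snd gp, q', p)) i m k = (\<Sum>s<2. hB gp s * f s i m k))"
    by (elim exE)
  have hB: "diag_restriction (\<lambda>p q'. wB g (q, q', p)) i m k = (\<Sum>s<2. hB (g, q) s * f s i m k)"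
    if "g < 6" "q \<in> ?J" "i < 2" "m < 3" "k < 2" for g q i m k
    using hB0[rule_format, of "(g, q)"] that by simp
  define sw :: "idx \<Rightarrow> idx" where "sw = prod.swap"
  have sw: "sw p \<in> ?J \<longleftrightarrow> p \<in> ?J" for p by (cases p) (auto simp: sw_def mat_idx_def)
  \<comment> \<open>Transposition exchanges the roles of \<open>a\<close> and \<open>b\<close>,
    hence of \<open>u\<close> and \<open>w\<close>. Because \<open>j'\<close> is dualised it also
    sends the power \<open>m\<close> of \<open>v\<close> to \<open>2 - m\<close>, with a sign except
    at \<open>m = 1\<close>.\<close>
  define f' where "f' s k m i = (if m = 1 then f s i m k else - f s i (2 - m) k)" for s k m i
  interpret B: limit_prolongation "\<lambda>g q q' p. wB g (sw q, sw q', sw p)" "\<lambda>g s q. hB (g, sw q) s" f'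
  proof
    show "\<forall>g<6. x g = 0"
      if h: "\<And>p p' q. \<lbrakk>p \<in> ?J; p' \<in> ?J; q \<in> ?J\<rbrakk> \<Longrightarrow> (\<Sum>g<6. x g * wB g (sw p, sw p', sw q)) = 0" for x
    proof (rule indB, safe)
      fix p1 p2 q1 q2 r1 r2 :: nat
      assume "(p1, p2) \<in> ?J" "(q1, q2) \<in> ?J" "(r1, r2) \<in> ?J"
      then show "(\<Sum>g<6. x g * wB g ((p1, p2), (q1, q2), (r1, r2))) = 0"
        using h[of "sw (p1, p2)" "sw (q1, q2)" "sw (r1, r2)"] by (simp add: sw_def mat_idx_def)
    qed
    show "wB g (sw p, sw p', sw q) = wB g (sw p', sw p, sw q)" if "g < 6" "p \<in> ?J" "p' \<in> ?J" "q \<in> ?J" for g p p' q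
      using symB[OF that(1)] that sw by blast
    show "diag_restriction (\<lambda>q' p. wB g (sw q, sw q', sw p)) k m i = (\<Sum>s<2. hB (g, sw q) s * f' s k m i)"
      if "g < 6" "q \<in> ?J" "k < 2" "m < 3" "i < 2" for g q k m i
    proof -
      have q: "sw q \<in> ?J" using that sw by blast
      have e: "diag_restriction (\<lambda>q' p. wB g (sw q, sw q', sw p)) k m i
        = (if m = 1 then diag_restriction (\<lambda>p q'. wB g (sw q, q', p)) i m k
           else - diag_restriction (\<lambda>p q'. wB g (sw q, q', p)) i (2 - m) k)"
        using less_3_cases[OF that(4)] by (auto simp: diag_restriction_def sw_def)
      show ?thesis unfolding e f'_def
        using hB[OF that(1) q that(5) _ that(3)] that(4) by (simp add: sum_negf)
    qed
  qed

  obtain P \<mu> where P: "\<And>s i m k. \<lbrakk>s < 2; i < 2; m < 3; k < 2\<rbrakk> \<Longrightarrow> f s i m k = \<mu> s i * P m k"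
    using A.generators_factor by blast
  obtain P' \<nu> where P': "\<And>s k m i. \<lbrakk>s < 2; k < 2; m < 3; i < 2\<rbrakk> \<Longrightarrow> f' s k m i = \<nu> s k * P' m i"
    using B.generators_factor by blast
  have "\<exists>m<3. \<exists>k<2. P m k \<noteq> 0"
  proof (rule ccontr)
    assume "\<not> ?thesis"
    then have "1 * f 0 i m k + 0 * f 1 i m k = 0" if "i < 2" "m < 3" "k < 2" for i m k using P that by simp
    from A.independent_generators[OF this] show False by simp
  qed
  then obtain m0 k0 where mk: "m0 < 3" "k0 < 2" "P m0 k0 \<noteq> 0" by blast
  define m1 where "m1 = 2 - m0"
  define \<sigma> :: complex where "\<sigma> = (if m0 = 1 then 1 else - 1)"
  \<comment> \<open>Comparing the two factorisations where \<open>P\<close> is nonzero shows that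
    \<open>\<mu> s i\<close> is a product of functions of \<open>s\<close> and \<open>i\<close>, so
    \<open>f 0\<close> and \<open>f 1\<close> satisfy a relation with coefficients
    \<open>\<nu> 1 k0\<close> and \<open>- \<nu> 0 k0\<close>. Independence makes both zero; then
    \<open>\<mu>\<close> and \<open>f\<close> vanish, against independence again.\<close>
  have fm: "\<mu> s i * P m0 k0 = \<sigma> * (\<nu> s k0 * P' m1 i)" if "s < 2" "i < 2" for s i
  proof -
    have "f' s k0 m1 i = \<sigma> * f s i m0 k0"
      using less_3_cases[OF mk(1)] by (auto simp: f'_def m1_def \<sigma>_def)
    moreover have "\<sigma> * \<sigma> = 1" by (simp add: \<sigma>_def)
    ultimately have "f s i m0 k0 = \<sigma> * f' s k0 m1 i" by (simp flip: mult.assoc)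
    then show ?thesis using P[of s i m0 k0] P'[of s k0 m1 i] that mk by (simp add: m1_def)
  qed
  have "\<nu> 1 k0 * f 0 i m k + (- \<nu> 0 k0) * f 1 i m k = 0" if "i < 2" "m < 3" "k < 2" for i m k
  proof -
    have "P m0 k0 * (\<nu> 1 k0 * \<mu> 0 i - \<nu> 0 k0 * \<mu> 1 i) = \<nu> 1 k0 * (\<mu> 0 i * P m0 k0) - \<nu> 0 k0 * (\<mu> 1 i * P m0 k0)"
      by (simp add: algebra_simps)
    also have "\<dots> = 0" using fm[of 0 i] fm[of 1 i] that by simp
    finally have "\<nu> 1 k0 * \<mu> 0 i - \<nu> 0 k0 * \<mu> 1 i = 0" using mk by simp
    moreover have "\<nu> 1 k0 * f 0 i m k + (- \<nu> 0 k0) * f 1 i m k = (\<nu> 1 k0 * \<mu> 0 i - \<nu> 0 k0 * \<mu> 1 i) * P m k"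
      using P that by (simp add: algebra_simps)
    ultimately show ?thesis by simp
  qed
  from A.independent_generators[OF this] have \<nu>: "\<nu> 1 k0 = 0" "\<nu> 0 k0 = 0" by auto
  have "\<mu> s i = 0" if "s < 2" "i < 2" for s i
  proof -
    have "s = 0 \<or> s = 1" using that by auto
    then have "\<nu> s k0 = 0" using \<nu> by auto
    then show ?thesis using fm[OF that] mk by simp
  qed
  then have "1 * f 0 i m k + 0 * f 1 i m k = 0" if "i < 2" "m < 3" "k < 2" for i m k using P that by simp
  from A.independent_generators[OF this] show False by simp
qed

section \<open>Border substitution\<close>

definition matmult_without_slice :: "nat \<Rightarrow> idx \<Rightarrow> tensor3" where
  "matmult_without_slice n p0 = (\<lambda>p q s. if p = p0 then 0 else matmult_tensor n p q s)"

text \<open>Projecting along the last vector \<open>a r\<close> kills one summand. The torus acting by \<open>L\<close>, \<open>K\<close>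
  fixes the matrix multiplication tensor and moves the line of \<open>a r\<close> to a coordinate line.\<close>
lemma matmult_without_slice_close:
  assumes n: "n > 0" and ap: "approximable n (matmult_tensor n) (Suc r)" and e: "e > 0"
  shows "\<exists>p0\<in>mat_idx n. \<exists>a b c. \<forall>p\<in>mat_idx n. \<forall>q\<in>mat_idx n. \<forall>z\<in>mat_idx n.
    norm (sum_rank_one r a b c p q z - matmult_without_slice n p0 p q z) < e"
proof -
  let ?J = "mat_idx n" and ?M = "matmult_tensor n"
  \<comment> \<open>\<open>s\<close> is the torus parameter and \<open>d\<close> the precision asked
    of the given approximation. The weights are at most \<open>1 / s\<^sup>2\<close>, so that
    approximation costs \<open>2 * d / s\<^sup>2 = e / 4\<close>, and isolating the slice costs at
    most \<open>s \<le> e / 2\<close>.\<close>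
  define s where "s = min 1 (e / 2)"
  have s: "0 < s" "s \<le> 1" "s \<le> e / 2" using e by (auto simp: s_def)
  define d where "d = e * s\<^sup>2 / 8"
  have d: "d > 0" using e s by (simp add: d_def)
  obtain a b c where abc: "\<And>p q z. \<lbrakk>p \<in> ?J; q \<in> ?J; z \<in> ?J\<rbrakk> \<Longrightarrow>
      norm (sum_rank_one (Suc r) a b c p q z - ?M p q z) < d"
    using ap d unfolding approximable_def by blast
  have ne: "?J \<noteq> {}" using n by (auto simp: mat_idx_def)
  then have "Max ((\<lambda>p. norm (a r p)) ` ?J) \<in> (\<lambda>p. norm (a r p)) ` ?J"
    by (intro Max_in) auto
  then obtain p0 where p0: "p0 \<in> ?J" "norm (a r p0) = Max ((\<lambda>p. norm (a r p)) ` ?J)" by auto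
  have mx: "norm (a r p) \<le> norm (a r p0)" if "p \<in> ?J" for p
    unfolding p0(2) using that by simp
  \<comment> \<open>The choice of \<open>p0\<close> as a coordinate of largest modulus bounds these
    quotients by 1. If \<open>a r\<close> vanishes on the index set, the default keeps
    \<open>\<alpha> p0 = 1\<close>.\<close>
  define \<alpha> where "\<alpha> p = (if a r p0 = 0 then (if p = p0 then 1 else 0) else a r p / a r p0)" for p
  have \<alpha>1: "\<alpha> p0 = 1" by (simp add: \<alpha>_def)
  have \<alpha>le: "norm (\<alpha> p) \<le> 1" if "p \<in> ?J" for p
    using mx[OF that] by (auto simp: \<alpha>_def norm_divide divide_le_eq_1)
  have \<alpha>a: "a r p = \<alpha> p * a r p0" if "p \<in> ?J" for p
    using mx[OF that] by (auto simp: \<alpha>_def)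
  define L where "L i = (if i = fst p0 then 1 else s)" for i
  define K where "K j = (if j = snd p0 then 1 else s)" for j
  have LK: "s \<le> L i" "L i \<le> 1" "0 < L i" "s \<le> K i" "K i \<le> 1" "0 < K i" for i
    using s by (auto simp: L_def K_def)
  \<comment> \<open>The total torus weight of an entry. It equals 1 on the support of the matrix
    multiplication tensor, where \<open>fst q = snd p\<close> and
    \<open>snd z = fst p\<close>.\<close>
  define W where "W p q z = L (fst p) * K (snd p) / (K (fst q) * L (snd z))" for p q z :: idx
  have W: "0 < W p q z" "W p q z \<le> 1 / s\<^sup>2" for p q z
  proof -
    show "0 < W p q z" using LK by (simp add: W_def)
    have "L (fst p) * K (snd p) \<le> 1 * 1" by (intro mult_mono) (use LK in \<open>auto intro: less_imp_le\<close>)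
    moreover have "s * s \<le> K (fst q) * L (snd z)" by (intro mult_mono) (use LK s in \<open>auto intro: less_imp_le\<close>)
    ultimately show "W p q z \<le> 1 / s\<^sup>2"
      unfolding W_def using s LK by (intro frac_le) (auto simp: power2_eq_square)
  qed
  define D where "D = sum_rank_one (Suc r) a b c"
  have WM: "of_real (W p q z) * ?M p q z = ?M p q z" for p q z
    using LK[of "fst p"] LK[of "snd p"]
    by (cases p; cases q; cases z) (auto simp: matmult_tensor_def W_def)
  have M1: "norm (?M p q z) \<le> 1" for p q z
    by (cases p; cases q; cases z) (auto simp: matmult_tensor_def)
  define a' where "a' l p = of_real (L (fst p) * K (snd p)) * (a l p - \<alpha> p * a l p0)" for l p
  define b' where "b' l q = b l q / of_real (K (fst q))" for l q
  define c' where "c' l z = c l z / of_real (L (snd z))" for l z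
  have "norm (sum_rank_one r a' b' c' p q z - matmult_without_slice n p0 p q z) < e"
    if J: "p \<in> ?J" "q \<in> ?J" "z \<in> ?J" for p q z
  proof -
    have "D p q z - \<alpha> p * D p0 q z = (\<Sum>l<Suc r. (a l p - \<alpha> p * a l p0) * b l q * c l z)"
      by (simp add: D_def sum_rank_one_def sum_distrib_left algebra_simps sum_subtractf)
    also have "\<dots> = (\<Sum>l<r. (a l p - \<alpha> p * a l p0) * b l q * c l z)"
      using \<alpha>a[OF J(1)] by simp
    finally have Dr: "D p q z - \<alpha> p * D p0 q z = (\<Sum>l<r. (a l p - \<alpha> p * a l p0) * b l q * c l z)" .
    have "sum_rank_one r a' b' c' p q z = of_real (W p q z) * (D p q z - \<alpha> p * D p0 q z)"
      unfolding Dr sum_distrib_left sum_rank_one_def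
      by (rule sum.cong) (auto simp: a'_def b'_def c'_def W_def)
    also have "\<dots> = of_real (W p q z) * (D p q z - ?M p q z)
        - of_real (W p q z) * \<alpha> p * (D p0 q z - ?M p0 q z)
        + (of_real (W p q z) * ?M p q z - of_real (W p q z) * \<alpha> p * ?M p0 q z)"
      by (simp add: algebra_simps)
    finally have eq: "sum_rank_one r a' b' c' p q z - matmult_without_slice n p0 p q z
        = of_real (W p q z) * (D p q z - ?M p q z)
        - of_real (W p q z) * \<alpha> p * (D p0 q z - ?M p0 q z)
        + (?M p q z - of_real (W p q z) * \<alpha> p * ?M p0 q z - matmult_without_slice n p0 p q z)"
      unfolding WM by simp
    have n1: "norm (of_real (W p q z) * (D p q z - ?M p q z)) \<le> 1 / s\<^sup>2 * d"
      unfolding norm_mult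
      by (intro mult_mono) (use W[of p q z] abc[OF J] s in \<open>auto simp: D_def intro: less_imp_le\<close>)
    have n2: "norm (of_real (W p q z) * \<alpha> p * (D p0 q z - ?M p0 q z)) \<le> 1 / s\<^sup>2 * 1 * d"
      unfolding norm_mult
      by (intro mult_mono) (use W[of p q z] abc[OF p0(1) J(2,3)] \<alpha>le[OF J(1)] s
          in \<open>auto simp: D_def intro: less_imp_le\<close>)
    have n3: "norm (?M p q z - of_real (W p q z) * \<alpha> p * ?M p0 q z - matmult_without_slice n p0 p q z) \<le> s"
    proof (cases "p = p0")
      case True
      show ?thesis unfolding True \<alpha>1 mult_1_right WM
        using s by (simp add: matmult_without_slice_def)
    next
      case False
      \<comment> \<open>For \<open>p \<noteq> p0\<close>, an entry in the support of the slice at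
        \<open>p0\<close> has at least one factor \<open>s\<close> in its weight, from
        \<open>L\<close> or from \<open>K\<close>.\<close>
      have "norm (of_real (W p q z) * \<alpha> p * ?M p0 q z) \<le> s"
      proof (cases "?M p0 q z = 0")
        case True
        then show ?thesis using s by simp
      next
        case nz: False
        then have "fst q = snd p0" "snd z = fst p0"
          by (cases p0; cases q; cases z; auto simp: matmult_tensor_def split: if_splits)+
        then have Weq: "W p q z = L (fst p) * K (snd p)" by (simp add: W_def L_def K_def)
        have "L (fst p) * K (snd p) \<le> s"
        proof (cases "fst p = fst p0")
          case True
          then have "snd p \<noteq> snd p0" using False by (auto simp: prod_eq_iff)
          then show ?thesis using True by (simp add: L_def K_def)
        next
          case False
          then have "L (fst p) * K (snd p) \<le> s * 1"
            by (intro mult_mono) (use LK s in \<open>auto simp: L_def intro: less_imp_le\<close>)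
          then show ?thesis by simp
        qed
        then have w: "W p q z \<le> s" using Weq by simp
        have "norm (of_real (W p q z) * \<alpha> p * ?M p0 q z) \<le> s * 1 * 1"
          unfolding norm_mult
          by (intro mult_mono) (use W(1)[of p q z] w \<alpha>le[OF J(1)] M1 s in auto)
        then show ?thesis by simp
      qed
      then show ?thesis using False by (simp add: matmult_without_slice_def norm_minus_commute)
    qed
    have "norm (sum_rank_one r a' b' c' p q z - matmult_without_slice n p0 p q z)
        \<le> 1 / s\<^sup>2 * d + 1 / s\<^sup>2 * 1 * d + s"
      unfolding eq
      by (intro order_trans[OF norm_triangle_ineq] add_mono order_trans[OF norm_triangle_ineq4] n1 n2 n3)
    also have "\<dots> = e / 4 + s" using s by (simp add: d_def field_simps)
    also have "\<dots> < e" using s(3) e by simp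
    finally show ?thesis .
  qed
  then show ?thesis using p0(1) by blast
qed

text \<open>The deleted index may vary with the precision, but it ranges over a finite set. If every
  index failed at some precision, the smallest of these precisions would contradict
  \<open>matmult_without_slice_close\<close>.\<close>

lemma border_substitution:
  assumes "n > 0" "approximable n (matmult_tensor n) (Suc r)"
  shows "\<exists>p0\<in>mat_idx n. approximable n (matmult_without_slice n p0) r"
proof (rule ccontr)
  let ?Q = "\<lambda>p0 e. \<exists>a b c. \<forall>p\<in>mat_idx n. \<forall>q\<in>mat_idx n. \<forall>z\<in>mat_idx n.
    norm (sum_rank_one r a b c p q z - matmult_without_slice n p0 p q z) < e"
  assume "\<not> ?thesis"
  then have "\<forall>p0. \<exists>e. p0 \<in> mat_idx n \<longrightarrow> e > 0 \<and> \<not> ?Q p0 e"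
    unfolding approximable_def by blast
  from choice[OF this] obtain E where E: "\<forall>p0. p0 \<in> mat_idx n \<longrightarrow> E p0 > 0 \<and> \<not> ?Q p0 (E p0)"
    by (elim exE)
  have ne: "mat_idx n \<noteq> {}" using assms(1) by (auto simp: mat_idx_def)
  have "\<forall>p0\<in>mat_idx n. 0 < E p0" using E by blast
  then have "Min (E ` mat_idx n) > 0" using ne by simp
  from matmult_without_slice_close[OF assms this] obtain p0 a b c where p0: "p0 \<in> mat_idx n"
    and Q: "\<forall>p\<in>mat_idx n. \<forall>q\<in>mat_idx n. \<forall>z\<in>mat_idx n.
      norm (sum_rank_one r a b c p q z - matmult_without_slice n p0 p q z) < Min (E ` mat_idx n)"
    by blast
  have "Min (E ` mat_idx n) \<le> E p0" using p0 by simp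
  then have "?Q p0 (E p0)" using Q less_le_trans by blast
  then show False using E p0 by blast
qed

section \<open>Koszul flattenings\<close>

definition wedge_sign :: "nat \<Rightarrow> nat set \<Rightarrow> complex" where
  "wedge_sign s R = (- 1) ^ card {x \<in> R. x < s}"

text \<open>Exterior multiplication by the vector \<open>a\<close> on the left; a form is stored as
  its coefficients on basis elements indexed by sets.\<close>

definition wedge :: "(nat \<Rightarrow> complex) \<Rightarrow> (nat set \<Rightarrow> complex) \<Rightarrow> nat set \<Rightarrow> complex" where
  "wedge a \<omega> R = (\<Sum>s\<in>R. wedge_sign s R * a s * \<omega> (R - {s}))"

lemma wedge_sign_nonzero [simp]: "wedge_sign s R \<noteq> 0"
  by (simp add: wedge_sign_def)

lemma wedge_sign_swap:
  assumes "finite R" "s \<in> R" "u \<in> R" "s < u"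
  shows "wedge_sign s R * wedge_sign u (R - {s}) = - (wedge_sign u R * wedge_sign s (R - {u}))"
proof -
  have "{x \<in> R. x < u} = insert s {x \<in> R - {s}. x < u}" using assms by auto
  moreover have "card (insert s {x \<in> R - {s}. x < u}) = Suc (card {x \<in> R - {s}. x < u})"
    by (rule card_insert_disjoint) (use assms in auto)
  ultimately have "wedge_sign u R = - wedge_sign u (R - {s})" by (simp add: wedge_sign_def)
  moreover have "{x \<in> R - {u}. x < s} = {x \<in> R. x < s}" using assms by auto
  ultimately show ?thesis by (simp add: wedge_sign_def)
qed

text \<open>Removing \<open>s\<close> and \<open>u\<close> in the two possible orders contributes
  with opposite signs, so the double sum equals its own negative.\<close>

lemma wedge_wedge:
  assumes "finite R"
  shows "wedge a (wedge a \<omega>) R = 0"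
proof -
  define F where "F s u = wedge_sign s R * wedge_sign u (R - {s}) * (a s * a u * \<omega> (R - {s} - {u}))" for s u
  have anti: "F s u = - F u s" if "s \<in> R" "u \<in> R" "s \<noteq> u" for s u
  proof -
    have c: "R - {s} - {u} = R - {u} - {s}" by auto
    have "wedge_sign s R * wedge_sign u (R - {s}) = - (wedge_sign u R * wedge_sign s (R - {u}))"
      using wedge_sign_swap[OF assms, of s u] wedge_sign_swap[OF assms, of u s] that
      by (cases "s < u") auto
    then show ?thesis unfolding F_def c by (simp add: mult.commute[of "a s"])
  qed
  have "wedge a (wedge a \<omega>) R = (\<Sum>s\<in>R. \<Sum>u\<in>R - {s}. F s u)"
    unfolding wedge_def F_def sum_distrib_left by (simp add: mult_ac)
  also have "\<dots> = (\<Sum>s\<in>R. \<Sum>u\<in>R. if s \<noteq> u then F s u else 0)"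
  proof (rule sum.cong[OF refl])
    fix s assume "s \<in> R"
    show "(\<Sum>u\<in>R - {s}. F s u) = (\<Sum>u\<in>R. if s \<noteq> u then F s u else 0)"
      by (rule sum.mono_neutral_cong_left) (use assms in auto)
  qed
  finally have eq: "wedge a (wedge a \<omega>) R = (\<Sum>s\<in>R. \<Sum>u\<in>R. if s \<noteq> u then F s u else 0)" .
  also have "\<dots> = (\<Sum>u\<in>R. \<Sum>s\<in>R. if s \<noteq> u then F s u else 0)" by (rule sum.swap)
  also have "\<dots> = (\<Sum>u\<in>R. \<Sum>s\<in>R. - (if u \<noteq> s then F u s else 0))"
  proof (intro sum.cong refl)
    fix u s assume "u \<in> R" "s \<in> R"
    then show "(if s \<noteq> u then F s u else 0) = - (if u \<noteq> s then F u s else 0)"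
      using anti[of s u] by (cases "s = u") simp_all
  qed
  also have "\<dots> = - wedge a (wedge a \<omega>) R" unfolding eq by (simp add: sum_negf)
  finally show ?thesis by simp
qed

text \<open>Hence wedging with a fixed vector of an \<open>N\<close>-dimensional space, from degree \<open>k\<close> to
  \<open>k + 1\<close>, has rank at most \<open>N - 1 choose k\<close>.\<close>
lemma wedge_eq_0_if_through:
  assumes a: "a \<sigma> \<noteq> 0" and R: "finite R"
    and thr: "\<And>R'. \<lbrakk>R' \<subseteq> insert \<sigma> R; card R' = card R; \<sigma> \<in> R'\<rbrakk> \<Longrightarrow> wedge a \<omega> R' = 0"
  shows "wedge a \<omega> R = 0"
proof (cases "\<sigma> \<in> R")
  case True
  then show ?thesis using thr by auto
next
  case False
  let ?R = "insert \<sigma> R"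
  \<comment> \<open>Every set other than \<open>R\<close> obtained from
    \<open>insert \<sigma> R\<close> by removing one element contains \<open>\<sigma>\<close>, so
    only the coefficient at \<open>R\<close> survives, multiplied by
    \<open>a \<sigma>\<close>.\<close>
  have "0 = wedge a (wedge a \<omega>) ?R" using wedge_wedge R by simp
  also have "\<dots> = wedge_sign \<sigma> ?R * a \<sigma> * wedge a \<omega> (?R - {\<sigma>})
      + (\<Sum>s\<in>R. wedge_sign s ?R * a s * wedge a \<omega> (?R - {s}))"
    unfolding wedge_def[of a "wedge a \<omega>"] using R False by simp
  also have "(\<Sum>s\<in>R. wedge_sign s ?R * a s * wedge a \<omega> (?R - {s})) = 0"
  proof (rule sum.neutral, safe)
    fix s assume s: "s \<in> R"
    have "wedge a \<omega> (?R - {s}) = 0"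
      by (rule thr) (use s False R in \<open>auto simp: card_Diff_singleton\<close>)
    then show "wedge_sign s ?R * a s * wedge a \<omega> (?R - {s}) = 0" by simp
  qed
  also have "?R - {\<sigma>} = R" using False by simp
  finally show ?thesis using a by simp
qed

definition wedge_coeff :: "nat set \<Rightarrow> (nat \<Rightarrow> complex) \<Rightarrow> nat set \<Rightarrow> complex" where
  "wedge_coeff R a S = (\<Sum>s\<in>R. if R - {s} = S then wedge_sign s R * a s else 0)"

lemma wedge_eq_sum_coeff:
  assumes "finite \<S>" "\<And>s. s \<in> R \<Longrightarrow> R - {s} \<in> \<S>"
  shows "wedge a \<omega> R = (\<Sum>S\<in>\<S>. wedge_coeff R a S * \<omega> S)"
proof -
  have "(\<Sum>S\<in>\<S>. wedge_coeff R a S * \<omega> S)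
      = (\<Sum>s\<in>R. \<Sum>S\<in>\<S>. (if R - {s} = S then wedge_sign s R * a s else 0) * \<omega> S)"
    unfolding wedge_coeff_def sum_distrib_right by (rule sum.swap)
  also have "\<dots> = (\<Sum>s\<in>R. wedge_sign s R * a s * \<omega> (R - {s}))"
  proof (rule sum.cong[OF refl])
    fix s assume s: "s \<in> R"
    have "(\<Sum>S\<in>\<S>. (if R - {s} = S then wedge_sign s R * a s else 0) * \<omega> S)
        = (\<Sum>S\<in>\<S>. if R - {s} = S then wedge_sign s R * a s * \<omega> S else 0)"
      by (rule sum.cong) auto
    then show "(\<Sum>S\<in>\<S>. (if R - {s} = S then wedge_sign s R * a s else 0) * \<omega> S)
        = wedge_sign s R * a s * \<omega> (R - {s})"
      using assms s by simp
  qed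
  finally show ?thesis by (simp add: wedge_def)
qed

text \<open>If \<open>y s1\<close> were nonzero, the rows other than \<open>s1\<close> would be
  fewer than the columns and kill a common nonzero \<open>z\<close>. Pairing the row relation with
  \<open>z\<close> shows that row \<open>s1\<close> kills it too, contradicting injectivity.\<close>

lemma transposed_system_trivial:
  fixes u :: "'s \<Rightarrow> 'i \<Rightarrow> 'a::field"
  assumes fin: "finite S" "finite I" "card S \<le> card I"
    and triv: "\<And>z. \<forall>s\<in>S. (\<Sum>i\<in>I. u s i * z i) = 0 \<Longrightarrow> \<forall>i\<in>I. z i = 0"
    and y: "\<forall>i\<in>I. (\<Sum>s\<in>S. y s * u s i) = 0"
  shows "\<forall>s\<in>S. y s = 0"
proof (rule ccontr)
  assume "\<not> ?thesis"
  then obtain s1 where s1: "s1 \<in> S" "y s1 \<noteq> 0" by blast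
  have "card (S - {s1}) < card I" using fin s1 by (metis card_Diff1_less order_less_le_trans)
  then obtain z where z: "\<exists>i\<in>I. z i \<noteq> 0" "\<forall>s\<in>S - {s1}. (\<Sum>i\<in>I. u s i * z i) = 0"
    using underdetermined_system_nontrivial[of "S - {s1}" I u] fin by auto
  have "0 = (\<Sum>i\<in>I. (\<Sum>s\<in>S. y s * u s i) * z i)" using y by simp
  also have "\<dots> = (\<Sum>s\<in>S. y s * (\<Sum>i\<in>I. u s i * z i))"
    unfolding sum_distrib_left sum_distrib_right by (subst sum.swap) (simp add: mult.assoc)
  also have "\<dots> = (\<Sum>s\<in>{s1}. y s * (\<Sum>i\<in>I. u s i * z i))"
    by (rule sum.mono_neutral_right) (use fin s1 z(2) in auto)
  finally have "(\<Sum>i\<in>I. u s1 i * z i) = 0" using s1 by simp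
  then have "\<forall>s\<in>S. (\<Sum>i\<in>I. u s i * z i) = 0" using z(2) by auto
  from triv[OF this] show False using z(1) by blast
qed

section \<open>Vectors in general position from polynomial values\<close>

definition linear_product :: "nat set \<Rightarrow> complex poly" where
  "linear_product A = (\<Prod>x\<in>A. [:- of_nat x, 1:])"

text \<open>Vieta for the top two coefficients. The second one later distinguishes
  \<open>{..<n}\<close> from other node sets by the sum of the nodes.\<close>

lemma linear_product_coeffs:
  assumes "finite A"
  shows "degree (linear_product A) \<le> card A \<and> coeff (linear_product A) (card A) = 1 \<and>
    (\<forall>m. card A = Suc m \<longrightarrow> coeff (linear_product A) m = - of_nat (\<Sum>A))"
  using assms
proof (induction A rule: finite_induct)
  case empty
  then show ?case by (simp add: linear_product_def)
next
  case (insert x A)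
  let ?P = "linear_product A"
  have eq: "linear_product (insert x A) = [:- of_nat x, 1:] * ?P"
    using insert by (simp add: linear_product_def)
  have c: "coeff ([:- of_nat x, 1:] * ?P) (Suc i) = coeff ?P i - of_nat x * coeff ?P (Suc i)" for i
    by simp
  have "degree ([:- of_nat x, 1:] * ?P) \<le> Suc (card A)"
    using insert.IH degree_mult_le[of "[:- of_nat x, 1:]" ?P] by simp
  moreover have "coeff ?P (Suc (card A)) = 0" using insert.IH by (intro coeff_eq_0) auto
  moreover have "coeff ([:- of_nat x, 1:] * ?P) (card A) = - of_nat (\<Sum>(insert x A))"
  proof (cases "card A")
    case 0
    then show ?thesis using insert.hyps by (simp add: linear_product_def)
  next
    case (Suc m)
    then show ?thesis using insert.IH insert.hyps c[of m] by simp
  qed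
  ultimately show ?case using insert c[of "card A"] unfolding eq by simp
qed

lemma poly_linear_product: "finite A \<Longrightarrow> poly (linear_product A) (of_nat s) = 0 \<longleftrightarrow> s \<in> A"
  by (auto simp: linear_product_def poly_prod)

lemma poly_eq_0_if_many_roots:
  fixes p :: "complex poly"
  assumes "finite R" "degree p < card R" "\<And>s::nat. s \<in> R \<Longrightarrow> poly p (of_nat s) = 0"
  shows "p = 0"
proof (rule ccontr)
  assume p: "p \<noteq> 0"
  have "card R = card ((of_nat :: nat \<Rightarrow> complex) ` R)"
    by (rule card_image [symmetric]) (simp add: inj_on_def)
  also have "\<dots> \<le> card {x. poly p x = 0}"
    by (rule card_mono) (use assms(3) p poly_roots_finite in auto)
  also have "\<dots> \<le> degree p" using card_poly_roots_bound[OF p] .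
  finally show False using assms(2) by simp
qed

text \<open>The vectors \<open>basis_eval i0 g s\<close> are the values at \<open>s\<close> of the polynomials \<open>1, x, \<dots>, x\<^sup>n\<^sup>-\<^sup>2\<close>
  together with \<open>g\<close>, which sits at position \<open>i0\<close>. With \<open>g\<close> vanishing at a set of nodes, the
  \<open>i0\<close>-coordinate is zero there and the vectors are otherwise in general position.\<close>
definition skip_index :: "nat \<Rightarrow> nat \<Rightarrow> nat" where
  "skip_index i0 i = (if i < i0 then i else i - 1)"

definition basis_eval :: "nat \<Rightarrow> complex poly \<Rightarrow> nat \<Rightarrow> nat \<Rightarrow> complex" where
  "basis_eval i0 g s i = (if i = i0 then poly g (of_nat s) else of_nat s ^ skip_index i0 i)"

definition skip_poly :: "nat \<Rightarrow> nat \<Rightarrow> (nat \<Rightarrow> complex) \<Rightarrow> complex poly" where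
  "skip_poly n i0 z = (\<Sum>i\<in>{..<n} - {i0}. monom (z i) (skip_index i0 i))"

lemma poly_skip_poly:
  "poly (skip_poly n i0 z) (of_nat s) = (\<Sum>i\<in>{..<n} - {i0}. basis_eval i0 g s i * z i)"
  by (simp add: skip_poly_def poly_sum poly_monom basis_eval_def mult.commute)

lemma basis_eval_sum:
  assumes "i0 < n"
  shows "(\<Sum>i<n. basis_eval i0 g s i * z i) = poly (smult (z i0) g + skip_poly n i0 z) (of_nat s)"
  using assms by (simp add: sum.remove[of "{..<n}" i0] poly_skip_poly[of _ _ _ _ g] basis_eval_def)

lemma coeff_skip_poly:
  assumes "i0 < n" "i < n" "i \<noteq> i0"
  shows "coeff (skip_poly n i0 z) (skip_index i0 i) = z i"
proof -
  have "coeff (skip_poly n i0 z) (skip_index i0 i)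
      = (\<Sum>i'\<in>{..<n} - {i0}. if i' = i then z i' else 0)"
    unfolding skip_poly_def coeff_sum
    by (rule sum.cong) (use assms in \<open>auto simp: skip_index_def split: if_splits\<close>)
  then show ?thesis using assms by simp
qed

lemma degree_skip_poly:
  assumes "i0 < n"
  shows "degree (skip_poly n i0 z) \<le> n - 2"
  unfolding skip_poly_def
proof (rule degree_sum_le)
  fix i assume "i \<in> {..<n} - {i0}"
  then have "skip_index i0 i \<le> n - 2" using assms by (auto simp: skip_index_def)
  then show "degree (monom (z i) (skip_index i0 i)) \<le> n - 2"
    using degree_monom_le le_trans by blast
qed simp

lemma skip_poly_eq_0D:
  assumes "i0 < n" "skip_poly n i0 z = 0"
  shows "\<forall>i\<in>{..<n} - {i0}. z i = 0"
  using coeff_skip_poly[OF assms(1), of _ z] assms(2) by auto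

text \<open>With \<open>n - 1\<close> nodes in \<open>C\<close>, \<open>linear_product C\<close> is
  monic of degree \<open>n - 1\<close> and completes the powers up to \<open>n - 2\<close> to a
  basis of the polynomials of degree below \<open>n\<close>. No nonzero one of these vanishes at
  \<open>n\<close> nodes.\<close>

lemma full_system_trivial:
  assumes n: "n \<ge> 2" "j0 < n" and C: "finite C" "card C = n - 1" and R: "finite R" "card R = n"
    and z: "\<forall>s\<in>R. (\<Sum>j<n. basis_eval j0 (linear_product C) s j * z j) = 0"
  shows "\<forall>j<n. z j = 0"
proof -
  let ?g = "linear_product C" and ?q = "skip_poly n j0 z"
  have g: "degree ?g \<le> n - 1" "coeff ?g (n - 1) = 1"
    using linear_product_coeffs[OF C(1)] C(2) by auto
  have q: "degree ?q \<le> n - 2" by (rule degree_skip_poly[OF n(2)])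
  have "smult (z j0) ?g + ?q = 0"
  proof (rule poly_eq_0_if_many_roots[OF R(1)])
    have "degree (smult (z j0) ?g + ?q) \<le> n - 1"
      by (rule degree_add_le) (use g q degree_smult_le[of "z j0" ?g] in linarith)+
    then show "degree (smult (z j0) ?g + ?q) < card R" using n R by linarith
  qed (use z basis_eval_sum[OF n(2)] in auto)
  moreover have "coeff ?q (n - 1) = 0" using q n by (intro coeff_eq_0) linarith
  ultimately have z0: "z j0 = 0" using g(2) by (metis coeff_add coeff_smult coeff_0 mult.right_neutral add.right_neutral)
  then have "?q = 0" using \<open>smult (z j0) ?g + ?q = 0\<close> by simp
  then show ?thesis using skip_poly_eq_0D[OF n(2)] z0 by (metis DiffI lessThan_iff singletonD)
qed

text \<open>Elements of \<open>R\<close> outside the segment are at least \<open>n\<close>, and the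
  equally many missing ones are at most \<open>n - 1\<close>.\<close>

lemma sum_greater_initial_segment:
  assumes "finite R" "card R = n" "R \<noteq> {..<n::nat}"
  shows "\<Sum>R > \<Sum>{..<n}"
proof -
  let ?A = "R - {..<n}" and ?B = "{..<n} - R"
  have "card R = card (R \<inter> {..<n}) + card ?A"
    using assms(1) by (rule card_Int_Diff)
  moreover have "card {..<n} = card (R \<inter> {..<n}) + card ?B"
    by (subst Int_commute) (rule card_Int_Diff, simp)
  ultimately have cd: "card ?A = card ?B" using assms(2) by simp
  have pos: "card ?B > 0"
  proof (rule ccontr)
    assume "\<not> ?thesis"
    then have "card ?A = 0" "card ?B = 0" using cd by simp_all
    then have "?A = {}" "?B = {}"
      using card_0_eq[of ?A] card_0_eq[of ?B] assms(1) by blast+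
    then show False using assms(3) by blast
  qed
  have n: "n > 0" using pos by (cases n) auto
  have "\<Sum>?B \<le> card ?B * (n - 1)"
    using sum_bounded_above[of ?B "\<lambda>x. x" "n - 1"] by force
  also have "\<dots> < card ?B * n" using pos n by simp
  also have "\<dots> \<le> \<Sum>?A" unfolding cd[symmetric]
    using sum_bounded_below[of ?A n "\<lambda>x. x"] by force
  finally have "\<Sum>?B < \<Sum>?A" .
  moreover have "\<Sum>R = \<Sum>(R \<inter> {..<n}) + \<Sum>?A" using assms(1) by (rule sum.Int_Diff)
  moreover have "\<Sum>{..<n} = \<Sum>(R \<inter> {..<n}) + \<Sum>?B" by (subst Int_commute) (rule sum.Int_Diff, simp)
  ultimately show ?thesis by linarith
qed

text \<open>A relation exhibits \<open>z i0 * (g - linear_product R)\<close> as a polynomial of degree at most \<open>n - 2\<close>,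
  although its coefficient at \<open>n - 1\<close> is a nonzero multiple of \<open>z i0\<close>.\<close>
lemma generic_subset_system_trivial:
  assumes n: "n \<ge> 2" "i0 < n" and R: "finite R" "card R = n" "R \<noteq> {..<n}"
    and z: "\<forall>s\<in>R. (\<Sum>i<n. basis_eval i0 (linear_product {..<n}) s i * z i) = 0"
  shows "\<forall>i<n. z i = 0"
proof -
  let ?g = "linear_product {..<n}" and ?q = "skip_poly n i0 z" and ?h = "linear_product R"
  obtain m where m: "n = Suc m" using n by (cases n) auto
  have g: "degree ?g \<le> n" "coeff ?g n = 1" "coeff ?g m = - of_nat (\<Sum>{..<n})"
    using linear_product_coeffs[of "{..<n}"] m by auto
  have h: "degree ?h \<le> n" "coeff ?h n = 1" "coeff ?h m = - of_nat (\<Sum>R)"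
    using linear_product_coeffs[OF R(1)] m R(2) by auto
  have q: "degree ?q \<le> n - 2" by (rule degree_skip_poly[OF n(2)])
  have qc: "coeff ?q n = 0" "coeff ?q m = 0" using q n m by (auto intro!: coeff_eq_0)
  define p where "p = smult (z i0) ?g + ?q - smult (z i0) ?h"
  have "p = 0"
  proof (rule poly_eq_0_if_many_roots[OF R(1)])
    have "degree p \<le> n" unfolding p_def
    proof (intro degree_add_le degree_diff_le)
      show "degree (smult (z i0) ?g) \<le> n" "degree (smult (z i0) ?h) \<le> n"
        using degree_smult_le[of "z i0"] g(1) h(1) le_trans by blast+
    qed (use q in linarith)
    moreover have "coeff p n = 0" using g h qc by (simp add: p_def)
    ultimately have "degree p < n" using m
      by (metis leading_coeff_0_iff degree_0 le_neq_implies_less zero_less_Suc)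
    then show "degree p < card R" using R by simp
    show "poly p (of_nat s) = 0" if "s \<in> R" for s
      using z that basis_eval_sum[OF n(2), of ?g s z] poly_linear_product[OF R(1), of s] by (simp add: p_def)
  qed
  then have "coeff p m = 0" by simp
  then have "z i0 * of_nat (\<Sum>R) = z i0 * of_nat (\<Sum>{..<n})"
    unfolding p_def coeff_diff coeff_add coeff_smult g(3) h(3) qc(2) by simp
  moreover have "(of_nat (\<Sum>R) :: complex) \<noteq> of_nat (\<Sum>{..<n})"
    using sum_greater_initial_segment[OF R] by (metis less_irrefl of_nat_eq_iff)
  ultimately have z0: "z i0 = 0" by (metis mult_cancel_left)
  then have "?q = 0" using \<open>p = 0\<close> by (simp add: p_def)
  then show ?thesis using skip_poly_eq_0D[OF n(2)] z0 by (metis DiffI lessThan_iff singletonD)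
qed

text \<open>Off the coordinate \<open>i0\<close> only polynomials of degree at most
  \<open>n - 2\<close> remain, so \<open>n - 1\<close> nodes suffice. This handles the exceptional
  set \<open>{..<n}\<close> once a node is removed.\<close>

lemma reduced_system_trivial:
  assumes n: "n \<ge> 2" "i0 < n" and R: "finite R" "card R = n - 1"
    and z: "\<forall>s\<in>R. (\<Sum>i\<in>{..<n} - {i0}. basis_eval i0 g s i * z i) = 0"
  shows "\<forall>i\<in>{..<n} - {i0}. z i = 0"
proof (rule skip_poly_eq_0D[OF n(2)], rule poly_eq_0_if_many_roots[OF R(1)])
  show "degree (skip_poly n i0 z) < card R"
    using degree_skip_poly[OF n(2), of z] n R(2) by linarith
qed (use z poly_skip_poly[of n i0 z _ g] in auto)

section \<open>Counting equations for the flattening\<close>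

definition subsets_of_card :: "nat \<Rightarrow> nat \<Rightarrow> nat set set" where
  "subsets_of_card N k = {S. S \<subseteq> {..<N} \<and> card S = k}"

lemma finite_subsets_of_card [simp]: "finite (subsets_of_card N k)"
  by (rule finite_subset[of _ "Pow {..<N}"]) (auto simp: subsets_of_card_def)

lemma card_subsets_of_card: "card (subsets_of_card N k) = N choose k"
  using n_subsets[of "{..<N}" k] by (simp add: subsets_of_card_def)

lemma subsets_of_card_finite: "R \<in> subsets_of_card N k \<Longrightarrow> finite R"
  by (auto simp: subsets_of_card_def intro: finite_subset)

lemma subsets_of_card_remove:
  "R \<in> subsets_of_card N (Suc k) \<Longrightarrow> s \<in> R \<Longrightarrow> R - {s} \<in> subsets_of_card N k"
  using subsets_of_card_finite[of R N] by (auto simp: subsets_of_card_def)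

lemma card_subsets_through:
  assumes "\<sigma> < Suc N"
  shows "card {R \<in> subsets_of_card (Suc N) (Suc k). \<sigma> \<in> R} \<le> N choose k"
proof -
  let ?T = "{S. S \<subseteq> {..<Suc N} - {\<sigma>} \<and> card S = k}"
  have fin: "finite ?T" by (rule finite_subset[of _ "Pow {..<Suc N}"]) auto
  have "R \<in> insert \<sigma> ` ?T" if "R \<in> subsets_of_card (Suc N) (Suc k)" "\<sigma> \<in> R" for R
  proof
    show "R = insert \<sigma> (R - {\<sigma>})" using that by auto
    show "R - {\<sigma>} \<in> ?T"
      using subsets_of_card_remove[OF that] by (auto simp: subsets_of_card_def)
  qed
  then have "card {R \<in> subsets_of_card (Suc N) (Suc k). \<sigma> \<in> R} \<le> card (insert \<sigma> ` ?T)"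
    by (intro card_mono) (use fin in auto)
  also have "\<dots> \<le> card ?T" by (rule card_image_le[OF fin])
  also have "\<dots> = card ({..<Suc N} - {\<sigma>}) choose k" by (rule n_subsets) simp
  also have "\<dots> = N choose k" using assms by simp
  finally show ?thesis .
qed

text \<open>The flattening of a summand is \<open>wedge\<close> by \<open>A l\<close> after
  contraction with \<open>b l\<close>. It vanishes once it does so at the sets through a node where
  \<open>A l\<close> is nonzero, which costs at most \<open>2 * m choose m\<close> equations.
  Together with \<open>n\<close> extra ones at \<open>S0\<close> these are fewer than the unknowns.
  They involve only \<open>a\<close> and \<open>b\<close>, so one \<open>w\<close> serves every
  \<open>c\<close>.\<close>

lemma koszul_flattening_kernel:
  fixes a b :: "nat \<Rightarrow> idx \<Rightarrow> complex" and X :: "nat \<Rightarrow> idx \<Rightarrow> complex" and v :: "nat \<Rightarrow> complex"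
  assumes count: "r * ((2 * m) choose m) + n < (Suc (2 * m) choose m) * n\<^sup>2"
    and S0: "S0 \<in> subsets_of_card (Suc (2 * m)) m"
  shows "\<exists>w. (\<exists>y\<in>subsets_of_card (Suc (2 * m)) m \<times> mat_idx n. w y \<noteq> 0) \<and>
    (\<forall>c z. \<forall>R\<in>subsets_of_card (Suc (2 * m)) (Suc m).
      (\<Sum>s\<in>R. wedge_sign s R * (\<Sum>q\<in>mat_idx n. (\<Sum>p\<in>mat_idx n. X s p * sum_rank_one r a b c p q z)
        * w (R - {s}, q))) = 0) \<and>
    (\<forall>k<n. (\<Sum>j<n. v j * w (S0, (j, k))) = 0)"
proof -
  let ?N = "Suc (2 * m)" and ?J = "mat_idx n"
  let ?S = "subsets_of_card ?N m" and ?R = "subsets_of_card ?N (Suc m)"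
  define A where "A l s = (\<Sum>p\<in>?J. X s p * a l p)" for l s
  \<comment> \<open>If \<open>A l\<close> vanishes at all nodes, \<open>0\<close> is only a
    placeholder, since the wedge is then zero.\<close>
  define \<sigma> where "\<sigma> l = (if \<exists>s<?N. A l s \<noteq> 0 then (SOME s. s < ?N \<and> A l s \<noteq> 0) else 0)" for l
  have \<sigma>: "\<sigma> l < ?N" "(\<exists>s<?N. A l s \<noteq> 0) \<Longrightarrow> A l (\<sigma> l) \<noteq> 0" for l
  proof -
    have "\<sigma> l < ?N \<and> A l (\<sigma> l) \<noteq> 0" if "\<exists>s<?N. A l s \<noteq> 0"
      using someI_ex[OF that] that by (simp add: \<sigma>_def)
    then show "\<sigma> l < ?N" "(\<exists>s<?N. A l s \<noteq> 0) \<Longrightarrow> A l (\<sigma> l) \<noteq> 0"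
      by (auto simp: \<sigma>_def)
  qed
  define thr where "thr l = {R \<in> ?R. \<sigma> l \<in> R}" for l
  have fthr: "finite (thr l)" for l by (simp add: thr_def)
  define I where "I = (SIGMA l:{..<r}. thr l) <+> {..<n}"
  have fI: "finite I" unfolding I_def using fthr by simp
  have "card I = (\<Sum>l<r. card (thr l)) + n"
    unfolding I_def using fthr by (simp add: card_Plus)
  also have "\<dots> \<le> (\<Sum>l<r. (2 * m) choose m) + n"
    unfolding thr_def by (intro add_right_mono sum_mono card_subsets_through \<sigma>(1))
  also have "\<dots> < card (?S \<times> ?J)"
    using count by (simp add: card_cartesian_product card_subsets_of_card mat_idx_def power2_eq_square)
  finally have cI: "card I < card (?S \<times> ?J)" .
  define C where "C i y = (case i of
      Inl (l, R) \<Rightarrow> wedge_coeff R (A l) (fst y) * b l (snd y)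
    | Inr k \<Rightarrow> if fst y = S0 \<and> snd (snd y) = k then v (fst (snd y)) else 0)"
    for i :: "(nat \<times> nat set) + nat" and y :: "nat set \<times> idx"
  obtain w where w: "\<exists>y\<in>?S \<times> ?J. w y \<noteq> 0" "\<forall>i\<in>I. (\<Sum>y\<in>?S \<times> ?J. C i y * w y) = 0"
    using underdetermined_system_nontrivial[OF fI _ cI, of C] by auto
  define \<omega> where "\<omega> l S = (\<Sum>q\<in>?J. b l q * w (S, q))" for l S
  have thr0: "wedge (A l) (\<omega> l) R = 0" if "l < r" "R \<in> thr l" for l R
  proof -
    have "Inl (l, R) \<in> I" using that by (auto simp: I_def)
    then have "0 = (\<Sum>y\<in>?S \<times> ?J. C (Inl (l, R)) y * w y)" using w(2) by auto
    also have "\<dots> = (\<Sum>S\<in>?S. \<Sum>q\<in>?J. wedge_coeff R (A l) S * b l q * w (S, q))"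
      by (simp add: C_def sum.cartesian_product split_def)
    also have "\<dots> = (\<Sum>S\<in>?S. wedge_coeff R (A l) S * \<omega> l S)"
      by (simp add: \<omega>_def sum_distrib_left mult.assoc)
    also have "\<dots> = wedge (A l) (\<omega> l) R"
      by (rule wedge_eq_sum_coeff[symmetric])
        (use that subsets_of_card_remove in \<open>auto simp: thr_def\<close>)
    finally show ?thesis by simp
  qed
  have all0: "wedge (A l) (\<omega> l) R = 0" if "l < r" "R \<in> ?R" for l R
  proof (cases "\<exists>s<?N. A l s \<noteq> 0")
    case True
    show ?thesis
    proof (rule wedge_eq_0_if_through[where \<sigma> = "\<sigma> l"])
      fix R' assume "R' \<subseteq> insert (\<sigma> l) R" "card R' = card R" "\<sigma> l \<in> R'"
      then show "wedge (A l) (\<omega> l) R' = 0"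
        using that \<sigma>(1)[of l] by (intro thr0) (auto simp: thr_def subsets_of_card_def)
    qed (use \<sigma>(2)[OF True] subsets_of_card_finite that in auto)
  next
    case False
    then show ?thesis using that(2) unfolding wedge_def subsets_of_card_def
      by (intro sum.neutral) (auto simp: subset_eq)
  qed
  have "(\<Sum>s\<in>R. wedge_sign s R * (\<Sum>q\<in>?J. (\<Sum>p\<in>?J. X s p * sum_rank_one r a b c p q z)
      * w (R - {s}, q))) = 0" if "R \<in> ?R" for c z R
  proof -
    have 1: "(\<Sum>p\<in>?J. X s p * sum_rank_one r a b c p q z) = (\<Sum>l<r. A l s * b l q * c l z)" for s q
      unfolding sum_rank_one_def A_def sum_distrib_left sum_distrib_right
      by (subst sum.swap) (simp add: mult.assoc)
    have 2: "(\<Sum>q\<in>?J. (\<Sum>l<r. A l s * b l q * c l z) * w (S, q)) = (\<Sum>l<r. c l z * (A l s * \<omega> l S))" for s S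
      unfolding \<omega>_def sum_distrib_left sum_distrib_right
      by (subst sum.swap) (simp add: mult_ac)
    have "(\<Sum>s\<in>R. wedge_sign s R * (\<Sum>q\<in>?J. (\<Sum>p\<in>?J. X s p * sum_rank_one r a b c p q z) * w (R - {s}, q)))
        = (\<Sum>l<r. c l z * wedge (A l) (\<omega> l) R)"
      unfolding 1 2 wedge_def sum_distrib_left by (subst sum.swap) (simp add: mult_ac)
    also have "\<dots> = 0" using all0 that by simp
    finally show ?thesis .
  qed
  moreover have "(\<Sum>j<n. v j * w (S0, (j, k))) = 0" if "k < n" for k
  proof -
    have "Inr k \<in> I" using that by (auto simp: I_def)
    then have "0 = (\<Sum>y\<in>?S \<times> ?J. C (Inr k) y * w y)" using w(2) by auto
    also have "\<dots> = (\<Sum>y\<in>(\<lambda>j. (S0, (j, k))) ` {..<n}. C (Inr k) y * w y)"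
      by (rule sum.mono_neutral_right) (use S0 that in \<open>auto simp: C_def mat_idx_def\<close>)
    also have "\<dots> = (\<Sum>j<n. v j * w (S0, (j, k)))"
      by (subst sum.reindex) (auto simp: inj_on_def C_def)
    finally show ?thesis by simp
  qed
  ultimately show ?thesis using w(1) by blast
qed

lemma contracted_matmult:
  assumes "k < n" "i < n"
  shows "(\<Sum>q\<in>mat_idx n. (\<Sum>p\<in>mat_idx n. u (fst p) * v (snd p) * matmult_tensor n p q (k, i)) * x q)
    = u i * (\<Sum>j<n. v j * x (j, k))"
proof -
  have in1: "(\<Sum>p\<in>mat_idx n. u (fst p) * v (snd p) * matmult_tensor n p q (k, i))
      = (if snd q = k then u i * v (fst q) else 0)" if "q \<in> mat_idx n" for q
  proof -
    have "(\<Sum>p\<in>mat_idx n. u (fst p) * v (snd p) * matmult_tensor n p q (k, i))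
        = (\<Sum>p\<in>{(i, fst q)}. u (fst p) * v (snd p) * matmult_tensor n p q (k, i))"
      by (rule sum.mono_neutral_right) (use that assms in \<open>auto simp: mat_idx_def matmult_tensor_def split: if_splits\<close>)
    then show ?thesis using that assms by (cases q) (auto simp: matmult_tensor_def mat_idx_def)
  qed
  have "(\<Sum>q\<in>mat_idx n. (\<Sum>p\<in>mat_idx n. u (fst p) * v (snd p) * matmult_tensor n p q (k, i)) * x q)
      = (\<Sum>q\<in>mat_idx n. (if snd q = k then u i * v (fst q) else 0) * x q)"
    by (rule sum.cong) (use in1 in auto)
  also have "\<dots> = (\<Sum>q\<in>(\<lambda>j. (j, k)) ` {..<n}. (if snd q = k then u i * v (fst q) else 0) * x q)"
    by (rule sum.mono_neutral_right) (use assms in \<open>auto simp: mat_idx_def\<close>)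
  also have "\<dots> = (\<Sum>j<n. u i * v j * x (j, k))"
    by (subst sum.reindex) (auto simp: inj_on_def)
  finally show ?thesis by (simp add: sum_distrib_left mult.assoc)
qed

lemma matmult_without_slice_not_approximable:
  assumes n: "n \<ge> 3" and p0: "p0 \<in> mat_idx n"
  shows "\<not> approximable n (matmult_without_slice n p0) (n * (2 * n - 1) - 1)"
proof
  define r where "r = n * (2 * n - 1) - 1"
  define m where "m = n - 1"
  have nm: "n = Suc m" "m \<ge> 2" using n by (auto simp: m_def)
  let ?N = "Suc (2 * m)" and ?J = "mat_idx n" and ?T = "matmult_without_slice n p0"
  let ?S = "subsets_of_card ?N m" and ?R = "subsets_of_card ?N n"
  assume "approximable n ?T (n * (2 * n - 1) - 1)"
  then have ap: "approximable n ?T r" by (simp add: r_def)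
  define i0 where "i0 = fst p0"
  define j0 where "j0 = snd p0"
  have ij: "i0 < n" "j0 < n" using p0 by (auto simp: i0_def j0_def mat_idx_def)
  \<comment> \<open>\<open>u s\<close> vanishes at \<open>i0\<close> for the nodes below
    \<open>n\<close>, and \<open>v s\<close> vanishes at \<open>j0\<close> for the others. Hence
    \<open>X s p0 = 0\<close> at all \<open>2 * n - 1\<close> nodes, and the deleted slice is never
    seen.\<close>
  define u where "u = basis_eval i0 (linear_product {..<n})"
  define v where "v = basis_eval j0 (linear_product {n..<?N})"
  define X where "X s p = u s (fst p) * v s (snd p)" for s p
  \<comment> \<open>The exceptional set \<open>{..<n}\<close> without the node \<open>0\<close>. All
    \<open>u s\<close> with \<open>s < n\<close> have zero coordinate at \<open>i0\<close>, so on
    \<open>{..<n}\<close> the flattening equations leave one degree of freedom for each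
    \<open>k\<close>; the extra \<open>n\<close> conditions remove it.\<close>
  define S0 where "S0 = {..<n} - {0}"
  have S0: "S0 \<in> ?S" using nm by (auto simp: S0_def subsets_of_card_def)
  have X0: "X s p0 = 0" if "s < ?N" for s
    using that by (cases "s < n")
      (auto simp: X_def u_def v_def basis_eval_def i0_def j0_def poly_linear_product)

  have r1: "Suc r = n * ?N" using nm by (simp add: r_def)
  \<comment> \<open>This identity makes \<open>Suc r * (2 * m choose m)\<close> exactly the number
    of unknowns. One summand fewer leaves a slack of \<open>2 * m choose m\<close>, which exceeds
    \<open>n\<close> from \<open>n = 3\<close> on.\<close>
  have bin: "n * (?N choose m) = ?N * ((2 * m) choose m)"
    using Suc_times_binomial[of m "2 * m"] binomial_symmetric[of m ?N] nm by simp
  have "2 * m choose 1 \<le> 2 * m choose (2 * m div 2)" by (rule binomial_maximum)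
  then have big: "n < (2 * m) choose m" using nm by simp
  have "r * ((2 * m) choose m) + n < Suc r * ((2 * m) choose m)" using big by simp
  also have "\<dots> = (?N choose m) * n\<^sup>2"
    unfolding r1 mult.assoc bin[symmetric] by (simp only: power2_eq_square mult_ac)
  finally have count: "r * ((2 * m) choose m) + n < (?N choose m) * n\<^sup>2" .

  have "\<forall>t. \<exists>abc. \<forall>p\<in>?J. \<forall>q\<in>?J. \<forall>z\<in>?J.
      norm (sum_rank_one r (fst abc) (fst (snd abc)) (snd (snd abc)) p q z - ?T p q z) < inverse (real (Suc t))"
    using ap unfolding approximable_def by (simp add: split_paired_Ex)
  from choice[OF this] obtain abc where abc: "\<forall>t. \<forall>p\<in>?J. \<forall>q\<in>?J. \<forall>z\<in>?J.
      norm (sum_rank_one r (fst (abc t)) (fst (snd (abc t))) (snd (snd (abc t))) p q z - ?T p q z)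
        < inverse (real (Suc t))" by (elim exE)
  define D where "D t = sum_rank_one r (fst (abc t)) (fst (snd (abc t))) (snd (snd (abc t)))" for t
  have D: "(\<lambda>t. D t p q z) \<longlonglongrightarrow> ?T p q z" if "p \<in> ?J" "q \<in> ?J" "z \<in> ?J" for p q z
    by (rule tendsto_if_inverse_Suc_bound) (use abc that in \<open>simp add: D_def\<close>)

  have "\<forall>t. \<exists>w. (\<exists>y\<in>?S \<times> ?J. w y \<noteq> 0) \<and>
      (\<forall>z. \<forall>R\<in>?R. (\<Sum>s\<in>R. wedge_sign s R * (\<Sum>q\<in>?J. (\<Sum>p\<in>?J. X s p * D t p q z) * w (R - {s}, q))) = 0) \<and>
      (\<forall>k<n. (\<Sum>j<n. v 0 j * w (S0, (j, k))) = 0)"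
  proof
    fix t
    obtain w where "(\<exists>y\<in>?S \<times> ?J. w y \<noteq> 0) \<and>
      (\<forall>c z. \<forall>R\<in>?R. (\<Sum>s\<in>R. wedge_sign s R * (\<Sum>q\<in>?J.
        (\<Sum>p\<in>?J. X s p * sum_rank_one r (fst (abc t)) (fst (snd (abc t))) c p q z) * w (R - {s}, q))) = 0) \<and>
      (\<forall>k<n. (\<Sum>j<n. v 0 j * w (S0, (j, k))) = 0)"
      using koszul_flattening_kernel[OF count S0, folded nm(1), where X = X and v = "v 0"
          and a = "fst (abc t)" and b = "fst (snd (abc t))"] by (elim exE)
    then show "\<exists>w. (\<exists>y\<in>?S \<times> ?J. w y \<noteq> 0) \<and>
      (\<forall>z. \<forall>R\<in>?R. (\<Sum>s\<in>R. wedge_sign s R * (\<Sum>q\<in>?J. (\<Sum>p\<in>?J. X s p * D t p q z) * w (R - {s}, q))) = 0) \<and>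
      (\<forall>k<n. (\<Sum>j<n. v 0 j * w (S0, (j, k))) = 0)"
      unfolding D_def by (intro exI[of _ w]) blast
  qed
  from choice[OF this] obtain w where w: "\<forall>t. (\<exists>y\<in>?S \<times> ?J. w t y \<noteq> 0) \<and>
      (\<forall>z. \<forall>R\<in>?R. (\<Sum>s\<in>R. wedge_sign s R * (\<Sum>q\<in>?J. (\<Sum>p\<in>?J. X s p * D t p q z) * w t (R - {s}, q))) = 0) \<and>
      (\<forall>k<n. (\<Sum>j<n. v 0 j * w t (S0, (j, k))) = 0)" by (elim exE)
  note wnz = w[rule_format, THEN conjunct1]
    and wker = w[rule_format, THEN conjunct2, THEN conjunct1, rule_format]
    and wS0 = w[rule_format, THEN conjunct2, THEN conjunct2, rule_format]
  have fin: "finite (?S \<times> ?J)" by simp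
  obtain \<phi> \<kappa> x where \<phi>: "strict_mono \<phi>"
    and x: "\<And>y. y \<in> ?S \<times> ?J \<Longrightarrow> (\<lambda>t. \<kappa> t * w (\<phi> t) y) \<longlonglongrightarrow> x y"
    and xnz: "\<exists>y\<in>?S \<times> ?J. x y \<noteq> 0"
    using nonzero_vectors_rescaled_limit[of "?S \<times> ?J" w, OF fin wnz] by blast

  have xker: "(\<Sum>s\<in>R. wedge_sign s R * (\<Sum>q\<in>?J. (\<Sum>p\<in>?J. X s p * ?T p q z) * x (R - {s}, q))) = 0"
    if R: "R \<in> ?R" and z: "z \<in> ?J" for R z
  proof -
    have "(\<lambda>t. \<Sum>s\<in>R. wedge_sign s R * (\<Sum>q\<in>?J. (\<Sum>p\<in>?J. X s p * D (\<phi> t) p q z) * (\<kappa> t * w (\<phi> t) (R - {s}, q))))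
      \<longlonglongrightarrow> (\<Sum>s\<in>R. wedge_sign s R * (\<Sum>q\<in>?J. (\<Sum>p\<in>?J. X s p * ?T p q z) * x (R - {s}, q)))"
      by (intro tendsto_intros x LIMSEQ_subseq_LIMSEQ[OF D \<phi>, unfolded o_def])
        (use z R nm(1) subsets_of_card_remove in auto)
    moreover have "(\<Sum>s\<in>R. wedge_sign s R * (\<Sum>q\<in>?J. (\<Sum>p\<in>?J. X s p * D (\<phi> t) p q z) * (\<kappa> t * w (\<phi> t) (R - {s}, q)))) = 0" for t
    proof -
      have "(\<Sum>s\<in>R. wedge_sign s R * (\<Sum>q\<in>?J. (\<Sum>p\<in>?J. X s p * D (\<phi> t) p q z) * (\<kappa> t * w (\<phi> t) (R - {s}, q))))
        = \<kappa> t * (\<Sum>s\<in>R. wedge_sign s R * (\<Sum>q\<in>?J. (\<Sum>p\<in>?J. X s p * D (\<phi> t) p q z) * w (\<phi> t) (R - {s}, q)))"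
        unfolding sum_distrib_left[of "\<kappa> t"]
      proof (rule sum.cong[OF refl])
        fix s
        have "(\<Sum>q\<in>?J. (\<Sum>p\<in>?J. X s p * D (\<phi> t) p q z) * (\<kappa> t * w (\<phi> t) (R - {s}, q)))
          = \<kappa> t * (\<Sum>q\<in>?J. (\<Sum>p\<in>?J. X s p * D (\<phi> t) p q z) * w (\<phi> t) (R - {s}, q))"
          unfolding sum_distrib_left[of "\<kappa> t"] by (simp add: mult.left_commute)
        then show "wedge_sign s R * (\<Sum>q\<in>?J. (\<Sum>p\<in>?J. X s p * D (\<phi> t) p q z) * (\<kappa> t * w (\<phi> t) (R - {s}, q)))
          = \<kappa> t * (wedge_sign s R * (\<Sum>q\<in>?J. (\<Sum>p\<in>?J. X s p * D (\<phi> t) p q z) * w (\<phi> t) (R - {s}, q)))"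
          by (simp add: mult.left_commute)
      qed
      then show ?thesis using wker[OF R] by simp
    qed
    ultimately show ?thesis by (simp add: LIMSEQ_const_iff)
  qed
  have xS0: "(\<Sum>j<n. v 0 j * x (S0, (j, k))) = 0" if "k < n" for k
  proof -
    have "(\<lambda>t. \<Sum>j<n. v 0 j * (\<kappa> t * w (\<phi> t) (S0, (j, k)))) \<longlonglongrightarrow> (\<Sum>j<n. v 0 j * x (S0, (j, k)))"
      by (intro tendsto_intros x) (use S0 that in \<open>auto simp: mat_idx_def\<close>)
    moreover have "(\<Sum>j<n. v 0 j * (\<kappa> t * w (\<phi> t) (S0, (j, k)))) = 0" for t
    proof -
      have "(\<Sum>j<n. v 0 j * (\<kappa> t * w (\<phi> t) (S0, (j, k)))) = \<kappa> t * (\<Sum>j<n. v 0 j * w (\<phi> t) (S0, (j, k)))"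
        unfolding sum_distrib_left by (simp add: mult.left_commute)
      then show ?thesis using wS0[OF that] by simp
    qed
    ultimately show ?thesis by (simp add: LIMSEQ_const_iff)
  qed

  \<comment> \<open>\<open>v s\<close> applied to column \<open>k\<close> of \<open>x\<close> at
    \<open>S\<close>. In the limit, the vectors \<open>u s\<close> weighted by
    \<open>Y k s (R - {s})\<close> up to sign sum to zero over each \<open>n\<close>-set
    \<open>R\<close>.\<close>
  define Y where "Y k s S = (\<Sum>j<n. v s j * x (S, (j, k)))" for k s S
  have Yeq: "(\<Sum>s\<in>R. (wedge_sign s R * Y k s (R - {s})) * u s i) = 0"
    if R: "R \<in> ?R" and ki: "k < n" "i < n" for R k i
  proof -
    have "0 = (\<Sum>s\<in>R. wedge_sign s R * (\<Sum>q\<in>?J. (\<Sum>p\<in>?J. X s p * ?T p q (k, i)) * x (R - {s}, q)))"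
      by (rule xker[symmetric]) (use R ki in \<open>auto simp: mat_idx_def\<close>)
    also have "\<dots> = (\<Sum>s\<in>R. (wedge_sign s R * Y k s (R - {s})) * u s i)"
    proof (rule sum.cong[OF refl])
      fix s assume s: "s \<in> R"
      then have "X s p0 = 0" using R by (intro X0) (auto simp: subsets_of_card_def)
      then have "X s p * ?T p q (k, i) = u s (fst p) * v s (snd p) * matmult_tensor n p q (k, i)" for p q
        by (cases "p = p0") (simp_all add: matmult_without_slice_def X_def)
      then show "wedge_sign s R * (\<Sum>q\<in>?J. (\<Sum>p\<in>?J. X s p * ?T p q (k, i)) * x (R - {s}, q))
          = (wedge_sign s R * Y k s (R - {s})) * u s i"
        using contracted_matmult[OF ki, of "u s" "v s" "\<lambda>q. x (R - {s}, q)"] by (simp add: Y_def)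
    qed
    finally show ?thesis by simp
  qed
  have Y0: "Y k s (R - {s}) = 0" if R: "R \<in> ?R" and k: "k < n" and s: "s \<in> R" for R k s
  proof -
    have fR: "finite R" "card R = n" using R subsets_of_card_finite[OF R] by (simp_all add: subsets_of_card_def)
    show ?thesis
    proof (cases "R = {..<n}")
      case False
      have "\<forall>s\<in>R. wedge_sign s R * Y k s (R - {s}) = 0"
      proof (rule transposed_system_trivial[where I = "{..<n}" and u = u])
        show "\<forall>i\<in>{..<n}. z i = 0" if "\<forall>s\<in>R. (\<Sum>i<n. u s i * z i) = 0" for z
          using generic_subset_system_trivial[OF _ ij(1) fR False, of z] that n by (simp add: u_def)
      qed (use fR Yeq[OF R k] in auto)
      then show ?thesis using s by simp
    next
      case True
      \<comment> \<open>The extra condition removes the node \<open>0\<close>, and the other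
        \<open>n - 1\<close> vectors \<open>u s\<close> are independent off
        \<open>i0\<close>.\<close>
      have 0: "Y k 0 (R - {0}) = 0" using xS0[OF k] by (simp add: Y_def True S0_def)
      have "\<forall>s\<in>R - {0}. wedge_sign s R * Y k s (R - {s}) = 0"
      proof (rule transposed_system_trivial[where I = "{..<n} - {i0}" and u = u])
        show "\<forall>i\<in>{..<n} - {i0}. z i = 0" if "\<forall>s\<in>R - {0}. (\<Sum>i\<in>{..<n} - {i0}. u s i * z i) = 0" for z
          by (rule reduced_system_trivial[where R = "R - {0}" and g = "linear_product {..<n}"])
            (use n ij fR True that in \<open>auto simp: u_def\<close>)
        show "\<forall>i\<in>{..<n} - {i0}. (\<Sum>s\<in>R - {0}. wedge_sign s R * Y k s (R - {s}) * u s i) = 0"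
        proof
          fix i assume i: "i \<in> {..<n} - {i0}"
          have "(\<Sum>s\<in>R. wedge_sign s R * Y k s (R - {s}) * u s i)
              = (\<Sum>s\<in>R - {0}. wedge_sign s R * Y k s (R - {s}) * u s i)"
            by (rule sum.mono_neutral_right) (use fR 0 in auto)
          then show "(\<Sum>s\<in>R - {0}. wedge_sign s R * Y k s (R - {s}) * u s i) = 0"
            using Yeq[OF R k, of i] i by simp
        qed
      qed (use True ij n in auto)
      then show ?thesis using s 0 by (cases "s = 0") auto
    qed
  qed
  have "x (S, (j, k)) = 0" if S: "S \<in> ?S" and jk: "j < n" "k < n" for S j k
  proof -
    have fS: "finite S" "card S = m" "S \<subseteq> {..<?N}" using S subsets_of_card_finite[OF S] by (simp_all add: subsets_of_card_def)
    \<comment> \<open>Each of the \<open>n\<close> nodes \<open>s\<close> outside \<open>S\<close>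
      gives an \<open>n\<close>-set \<open>insert s S\<close>, so \<open>n\<close> independent
      vectors \<open>v s\<close> annihilate every column of \<open>x\<close> at
      \<open>S\<close>.\<close>
    have "\<forall>j<n. x (S, (j, k)) = 0"
    proof (rule full_system_trivial[where ?j0.0 = j0 and C = "{n..<?N}" and R = "{..<?N} - S"])
      show "card ({..<?N} - S) = n" using fS nm by (simp add: card_Diff_subset)
      show "\<forall>s\<in>{..<?N} - S. (\<Sum>j<n. basis_eval j0 (linear_product {n..<?N}) s j * x (S, (j, k))) = 0"
      proof
        fix s assume s: "s \<in> {..<?N} - S"
        have "insert s S \<in> ?R" using s fS nm by (auto simp: subsets_of_card_def)
        from Y0[OF this jk(2), of s] s show "(\<Sum>j<n. basis_eval j0 (linear_product {n..<?N}) s j * x (S, (j, k))) = 0"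
          by (simp add: Y_def v_def)
      qed
    qed (use nm ij in auto)
    then show ?thesis using jk by blast
  qed
  then have "\<forall>y\<in>?S \<times> ?J. x y = 0" by (auto simp: mat_idx_def)
  then show False using xnz by blast
qed

section \<open>The lower bound\<close>

lemma border_rank_le_mono:
  assumes "border_rank_le n T r" "r \<le> r'"
  shows "border_rank_le n T r'"
proof -
  obtain a b c where abc: "\<forall>p\<in>mat_idx n. \<forall>q\<in>mat_idx n. \<forall>s\<in>mat_idx n.
      (\<lambda>t. sum_rank_one r (a t) (b t) (c t) p q s) \<longlonglongrightarrow> T p q s"
    using assms(1) unfolding border_rank_le_def by blast
  define a' where "a' t l p = (if l < r then a t l p else 0)" for t l p
  have eq: "sum_rank_one r' (a' t) (b t) (c t) p q s = sum_rank_one r (a t) (b t) (c t) p q s" for t p q s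
    unfolding sum_rank_one_def
    by (rule sum.mono_neutral_cong_right) (use assms(2) in \<open>auto simp: a'_def\<close>)
  show ?thesis unfolding border_rank_le_def
    by (rule exI[of _ a'], rule exI[of _ b], rule exI[of _ c]) (use abc eq in simp)
qed

text \<open>Expansion in the standard basis; it ensures that the \<open>LEAST\<close> in
  \<open>border_rank\<close> is attained.\<close>

lemma ex_border_rank_le: "\<exists>r. border_rank_le n T r"
proof -
  let ?K = "mat_idx n \<times> mat_idx n \<times> mat_idx n"
  obtain f where f: "bij_betw f {..<card ?K} ?K"
    using ex_bij_betw_nat_finite[of ?K] by (auto simp: atLeast0LessThan)
  define a where "a l p = (if fst (f l) = p then T p (fst (snd (f l))) (snd (snd (f l))) else 0)" for l p
  define b where "b l q = (if fst (snd (f l)) = q then 1 else 0 :: complex)" for l q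
  define c where "c l s = (if snd (snd (f l)) = s then 1 else 0 :: complex)" for l s
  have "sum_rank_one (card ?K) a b c p q s = T p q s"
    if "p \<in> mat_idx n" "q \<in> mat_idx n" "s \<in> mat_idx n" for p q s
  proof -
    have "sum_rank_one (card ?K) a b c p q s = (\<Sum>l<card ?K. if f l = (p, q, s) then T p q s else 0)"
      unfolding sum_rank_one_def
    proof (rule sum.cong[OF refl])
      fix l
      show "a l p * b l q * c l s = (if f l = (p, q, s) then T p q s else 0)"
        by (cases "f l") (auto simp: a_def b_def c_def)
    qed
    also have "\<dots> = (\<Sum>y\<in>?K. if y = (p, q, s) then T p q s else 0)"
      by (rule sum.reindex_bij_betw[OF f])
    also have "\<dots> = T p q s" using that by simp
    finally show ?thesis .
  qed
  note dec = this
  have "border_rank_le n T (card ?K)"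
    unfolding border_rank_le_def
    by (rule exI[of _ "\<lambda>_. a"], rule exI[of _ "\<lambda>_. b"], rule exI[of _ "\<lambda>_. c"]) (use dec in simp)
  then show ?thesis ..
qed

theorem theorem6p2:
  fixes n :: nat
  assumes "n \<ge> 2"
  shows "border_rank n (matmult_tensor n) \<ge> 2 * n^2 - n + 1"
proof (rule ccontr)
  assume "\<not> ?thesis"
  then have le: "border_rank n (matmult_tensor n) \<le> 2 * n^2 - n" by simp
  have "border_rank_le n (matmult_tensor n) (border_rank n (matmult_tensor n))"
    unfolding border_rank_def by (rule LeastI_ex[OF ex_border_rank_le])
  then have ap: "approximable n (matmult_tensor n) (2 * n^2 - n)"
    using border_rank_le_imp_approximable border_rank_le_mono[OF _ le] by blast
  have eq: "2 * n^2 - n = n * (2 * n - 1)"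
    by (simp add: power2_eq_square diff_mult_distrib2)
  show False
  proof (cases "n = 2")
    case True
    then show ?thesis using ap matmult_2_not_approximable_6 by simp
  next
    case False
    then have n: "n \<ge> 3" using assms by simp
    \<comment> \<open>Border substitution uses up one summand.\<close>
    have "Suc (n * (2 * n - 1) - 1) = n * (2 * n - 1)" using n by simp
    then have "approximable n (matmult_tensor n) (Suc (n * (2 * n - 1) - 1))" using ap eq by simp
    from border_substitution[OF _ this] n
    show ?thesis using matmult_without_slice_not_approximable[OF n] by auto
  qed
qed

end
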